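(* Let $P\subset\mathbb{R}^3$ be a weakly convex polyhedron which is star-shaped with respect to one of its vertices. Then $P$ is infinitesimally rigid.
   Context: A polyhedron $P$ is a compact region of $\mathbb{R}^3$ bounded by a closed embedded polyhedral surface (not necessarily convex); its vertices, edges and faces are those of its boundary surface. Weakly convex: the vertices of $P$ are the vertices of a convex polyhedron (i.e. every vertex of $P$ is an extreme point of the convex hull of $P$). Star-shaped with respect to a vertex $v_0$: the interior of $P$ has a decomposition as the union of finitely many non-degenerate simplices (tetrahedra), whose vertices are vertices of $P$, all having $v_0$ as one of their vertices, with pairwise disjoint interiors, which meet each other along common faces and meet the boundary of $P$ along faces (of the simplices and of the triangulated boundary), i.e. they form a triangulation of $P$ compatible with the triangulation of the boundary of $P$. Triangulated boundary: all polyhedra are taken to be triangulated: non-triangular faces are subdivided into triangles by adding "flat" edges (diagonals), without adding vertices. For $P$ star-shaped with respect to $v_0$, the non-triangular faces containing $v_0$ are subdivided using only diagonals containing $v_0$, so that the triangulation of the boundary is compatible with a triangulation of the interior of $P$ in which all simplices contain $v_0$. Infinitesimal rigidity: a first-order deformation of $P$ is an assignment of a vector of $\mathbb{R}^3$ to each vertex (extended affinely to each triangular face). It is trivial if it is the restriction of a Killing vector field of $\mathbb{R}^3$ (infinitesimal isometry). $P$ is infinitesimally rigid if any non-trivial first-order deformation induces a non-zero variation of the metric on one of the (triangular) faces, equivalently if any first-order deformation which preserves to first order the lengths of all edges of the triangulated boundary is trivial. *)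

theory Defs
  imports "HOL-Analysis.Analysis"
begin

(* A closed surface is a nonempty compact connected 2-manifold without boundary; compactness
   follows here from S being the union of a finite simplicial complex. *)
definition closed_polyhedral_surface :: "(real^3) set \<Rightarrow> bool" where
  "closed_polyhedral_surface S \<longleftrightarrow>
     S \<noteq> {} \<and> connected S \<and>
     (\<exists>C. simplicial_complex C \<and> \<Union>C = S) \<and>
     (\<forall>x\<in>S. \<exists>U. x \<in> U \<and> openin (top_of_set S) U \<and> U homeomorphic (ball 0 1 :: (real^2) set))"

(* Not to be confused with the library's "polyhedron", a finite intersection of half-spaces. *)
definition solid_polyhedron :: "(real^3) set \<Rightarrow> bool" where
  "solid_polyhedron P \<longleftrightarrow>
     compact P \<and> P = closure (interior P) \<and> connected (interior P) \<and>
     closed_polyhedral_surface (frontier P)"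

(* A point of a polyhedral surface lies in the interior of a face or of an edge (so that the
   surface coincides near it with a plane or with two half-planes having a common boundary line)
   exactly when the surface is, near that point, invariant under translations in some direction d.
   The vertices are the remaining points. *)
definition surface_vertices :: "(real^3) set \<Rightarrow> (real^3) set" where
  "surface_vertices S =
     {x\<in>S. \<not> (\<exists>d e. d \<noteq> 0 \<and> e > 0 \<and>
        (\<forall>y t. y \<in> ball x e \<and> y + t *\<^sub>R d \<in> ball x e \<longrightarrow> (y \<in> S \<longleftrightarrow> y + t *\<^sub>R d \<in> S)))}"

definition vertices_of :: "(real^3) set \<Rightarrow> (real^3) set" where
  "vertices_of P = surface_vertices (frontier P)"

definition weakly_convex :: "(real^3) set \<Rightarrow> bool" where
  "weakly_convex P \<longleftrightarrow> (\<forall>v\<in>vertices_of P. v extreme_point_of (convex hull P))"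

definition complex_vertices :: "(real^3) set set \<Rightarrow> (real^3) set" where
  "complex_vertices T = {v. {v} \<in> T}"

(* A subdivision of the faces of P into triangles that adds no vertices.  T contains the
   triangles together with all their edges and vertices (and the empty simplex). *)
definition boundary_triangulation :: "(real^3) set \<Rightarrow> (real^3) set set \<Rightarrow> bool" where
  "boundary_triangulation P T \<longleftrightarrow>
     simplicial_complex T \<and> \<Union>T = frontier P \<and> complex_vertices T = vertices_of P"

(* D is the set of tetrahedra of the decomposition.  By the library definition of triangulation,
   any two of them meet along a common (possibly empty) face, so distinct ones have disjoint
   interiors.  Since all tetrahedra contain v0, the triangles of T in a face of P through v0 are
   forced to have v0 as a vertex, i.e. such a face is cut by diagonals through v0 only. *)
definition star_shaped_wrt :: "(real^3) set \<Rightarrow> (real^3) set set \<Rightarrow> real^3 \<Rightarrow> bool" where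
  "star_shaped_wrt P T v0 \<longleftrightarrow>
     (\<exists>D. triangulation D \<and> \<Union>D = P \<and>
        (\<forall>K\<in>D. 3 simplex K \<and> v0 extreme_point_of K \<and>
                (\<forall>v. v extreme_point_of K \<longrightarrow> v \<in> vertices_of P)) \<and>
        (\<forall>K\<in>D. \<forall>s\<in>T. (K \<inter> s) face_of K \<and> (K \<inter> s) face_of s))"

(* The Killing equation for the Euclidean metric: the derivative is everywhere skew-symmetric. *)
definition killing_field :: "(real^3 \<Rightarrow> real^3) \<Rightarrow> bool" where
  "killing_field X \<longleftrightarrow>
     (\<forall>x. \<exists>A. (X has_derivative A) (at x) \<and> (\<forall>u w. A u \<bullet> w + u \<bullet> A w = 0))"

(* A first-order deformation is given by its values on the vertices of T; the values of q
   elsewhere are irrelevant. *)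
definition trivial_deformation :: "(real^3) set set \<Rightarrow> (real^3 \<Rightarrow> real^3) \<Rightarrow> bool" where
  "trivial_deformation T q \<longleftrightarrow> (\<exists>X. killing_field X \<and> (\<forall>v\<in>complex_vertices T. q v = X v))"

definition preserves_edge_lengths :: "(real^3) set set \<Rightarrow> (real^3 \<Rightarrow> real^3) \<Rightarrow> bool" where
  "preserves_edge_lengths T q \<longleftrightarrow>
     (\<forall>u v. u \<noteq> v \<and> closed_segment u v \<in> T \<longrightarrow>
        ((\<lambda>t. dist (u + t *\<^sub>R q u) (v + t *\<^sub>R q v)) has_real_derivative 0) (at 0))"

definition infinitesimally_rigid :: "(real^3) set set \<Rightarrow> bool" where
  "infinitesimally_rigid T \<longleftrightarrow> (\<forall>q. preserves_edge_lengths T q \<longrightarrow> trivial_deformation T q)"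

end

(* Put v0 = 0 and let q(v0) = 0. Let rho_i = <q_i, v_i> be the first-order change of |v_i|^2 / 2; it
   vanishes for edges v0 v_i of the boundary. In an affine chart p_i = v_i / a(v_i) of the link of v0,
   let g and h be the piecewise affine functions with values rho_i / a(v_i) and 1 / a(v_i). On each
   tetrahedron the strain of q is the symmetric product of the linear functions defined by g and h,
   and the matching of q across common faces forces the sum over the edges ij of the link of
   (g_i - g_j)^2 times the bend of h along ij to vanish. Since this sum only depends on the values of
   h at the vertices, h may be replaced by a strongly convex function with the same values, which
   exists by weak convexity. Then every triangle contributes with the same sign, strictly so unless
   g is constant on it. As g is constant on triangles and zero on the boundary, an area count gives
   g = 0. Hence q is a rotation on every tetrahedron, and all these rotations agree because the
   interior of P is connected. *)
theory Submission
  imports Defs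
begin

subsection \<open>Mean subgradients of a convex function along segments\<close>

text \<open>The link of \<open>v0\<close> need not be convex, so the bends of \<open>h\<close> have
  no common sign. To use the freedom in \<open>h\<close>, the bend along an edge is split between
  the two adjacent triangles by comparing each of them with one vector \<open>C\<close> attached to
  the edge. Any \<open>C\<close> with the right increment between the end points would do so far,
  since its part cancels between the two sides. The sign comes from taking the mean gradient of a
  convex function over the edge: such means are additive when an edge is cut and monotone between
  edges with a common end, so a triangle can be cut along the level line of \<open>g\<close> through
  its middle vertex. The convex function is a maximum of linear functions and in general not
  differentiable, hence the subgradients. The chart is kept as the plane
  \<open>a \<bullet> p = 1\<close> in space, where affine functions become linear and oriented areas
  become triple products.\<close>

text \<open>Since \<open>\<psi>\<close> may jump, the argument is by partition. The subgradient
  inequality makes \<open>\<psi>\<close> monotone, and both the increment of \<open>f\<close> and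
  the integral over \<open>{s..t}\<close> lie between \<open>(t - s) * \<psi> s\<close> and
  \<open>(t - s) * \<psi> t\<close>. On equal pieces the errors telescope to a bound that tends to
  0.\<close>

lemma integral_of_subgradient:
  fixes f \<psi> :: "real \<Rightarrow> real"
  assumes sub: "\<And>s t. \<psi> s * (t - s) \<le> f t - f s"
    and int: "\<psi> integrable_on {0..1}"
  shows "integral {0..1} \<psi> = f 1 - f 0"
proof -
  have mono: "\<psi> s \<le> \<psi> t" if "s \<le> t" for s t
  proof (cases "s = t")
    case False
    have "\<psi> s * (t - s) \<le> \<psi> t * (t - s)"
      using sub[of s t] sub[of t s] by (simp add: algebra_simps)
    then show ?thesis using False that by simp
  qed auto
  define D where "D t = f t - integral {0..t} \<psi>" for t
  have step: "\<bar>D t - D s\<bar> \<le> (t - s) * (\<psi> t - \<psi> s)" if st: "0 \<le> s" "s \<le> t" "t \<le> 1" for s t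
  proof -
    have i1: "\<psi> integrable_on {0..t}" and i2: "\<psi> integrable_on {s..t}"
      using int st by (auto intro: integrable_subinterval_real)
    have "integral {0..s} \<psi> + integral {s..t} \<psi> = integral {0..t} \<psi>"
      using st i1 by (intro Henstock_Kurzweil_Integration.integral_combine) auto
    moreover have "integral {s..t} (\<lambda>_. \<psi> s) \<le> integral {s..t} \<psi>"
      by (intro integral_le i2) (auto intro: mono)
    moreover have "integral {s..t} \<psi> \<le> integral {s..t} (\<lambda>_. \<psi> t)"
      by (intro integral_le i2) (auto intro: mono)
    ultimately show ?thesis
      using sub[of s t] sub[of t s] st by (simp add: D_def algebra_simps abs_le_iff)
  qed
  have "\<bar>D 1 - D 0\<bar> \<le> (\<psi> 1 - \<psi> 0) / real (Suc n)" for n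
  proof -
    let ?N = "real (Suc n)"
    have "D 1 - D 0 = (\<Sum>k<Suc n. D (real (Suc k) / ?N) - D (real k / ?N))"
      by (subst sum_lessThan_telescope) simp
    also have "\<bar>\<dots>\<bar> \<le> (\<Sum>k<Suc n. \<bar>D (real (Suc k) / ?N) - D (real k / ?N)\<bar>)"
      by (rule sum_abs)
    also have "\<dots> \<le> (\<Sum>k<Suc n. (1 / ?N) * (\<psi> (real (Suc k) / ?N) - \<psi> (real k / ?N)))"
    proof (rule sum_mono)
      fix k assume k: "k \<in> {..<Suc n}"
      have e: "real (Suc k) / ?N - real k / ?N = 1 / ?N"
        by (simp add: diff_divide_distrib[symmetric])
      have "\<bar>D (real (Suc k) / ?N) - D (real k / ?N)\<bar>
          \<le> (real (Suc k) / ?N - real k / ?N) * (\<psi> (real (Suc k) / ?N) - \<psi> (real k / ?N))"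
        using k by (intro step divide_right_mono) (auto simp: divide_le_eq)
      then show "\<bar>D (real (Suc k) / ?N) - D (real k / ?N)\<bar>
          \<le> (1 / ?N) * (\<psi> (real (Suc k) / ?N) - \<psi> (real k / ?N))"
        unfolding e .
    qed
    also have "\<dots> = (1 / ?N) * (\<psi> 1 - \<psi> 0)"
      by (simp only: sum_distrib_left[symmetric])
        (subst sum_lessThan_telescope, simp)
    finally show ?thesis by simp
  qed
  moreover have "(\<lambda>n. (\<psi> 1 - \<psi> 0) / real (Suc n)) \<longlonglongrightarrow> 0"
    by (rule LIMSEQ_Suc[OF lim_const_over_n])
  ultimately have "\<bar>D 1 - D 0\<bar> \<le> 0"
    by (intro LIMSEQ_le_const[where X = "\<lambda>n. (\<psi> 1 - \<psi> 0) / real (Suc n)"]) auto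
  then show ?thesis by (simp add: D_def)
qed

text \<open>\<open>C p q\<close> is the mean over the segment from \<open>p\<close> to \<open>q\<close> of a subgradient selection of the
  maximum of the linear functions given by \<open>B\<close>.\<close>

lemma mean_subgradient_exists:
  fixes B :: "'a::euclidean_space set"
  assumes "finite B" "B \<noteq> {}"
  obtains C :: "'a \<Rightarrow> 'a \<Rightarrow> 'a" where
    "\<And>p q. C p q = C q p"
    "\<And>p q. C p q \<bullet> (q - p) = Max ((\<bullet>) q ` B) - Max ((\<bullet>) p ` B)"
    "\<And>p c d. (C p c - C p d) \<bullet> (c - d) \<ge> 0"
    "\<And>p q m. 0 \<le> m \<Longrightarrow> m \<le> 1 \<Longrightarrow>
       C p q = m *\<^sub>R C p (p + m *\<^sub>R (q - p)) + (1 - m) *\<^sub>R C (p + m *\<^sub>R (q - p)) q"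
proof -
  obtain b :: "nat \<Rightarrow> 'a" and n where B: "B = b ` {..<n}"
    using assms(1) by (metis finite_imp_nat_seg_image_inj_on lessThan_def)
  define is_max where "is_max x i \<longleftrightarrow> i < n \<and> (\<forall>j<n. x \<bullet> b j \<le> x \<bullet> b i)" for x i
  \<comment> \<open>At points where several linear functions attain the maximum, the least index
    selects one of them measurably.\<close>
  define G where "G x = b (LEAST i. is_max x i)" for x
  define u where "u x = Max ((\<bullet>) x ` B)" for x
  have ex: "\<exists>i. is_max x i" for x
  proof -
    have "Max ((\<bullet>) x ` B) \<in> (\<bullet>) x ` B" using assms by (intro Max_in) auto
    then obtain i where i: "i < n" "Max ((\<bullet>) x ` B) = x \<bullet> b i" using B by auto
    have "x \<bullet> b j \<le> x \<bullet> b i" if "j < n" for j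
      using Max_ge[of "(\<bullet>) x ` B" "x \<bullet> b j"] assms that i(2) unfolding B by auto
    then show ?thesis using i by (auto simp: is_max_def)
  qed
  have least: "is_max x (LEAST i. is_max x i)" for x
    using ex by (auto intro: LeastI_ex)
  have G_in: "G x \<in> B" for x using least[of x] by (auto simp: G_def is_max_def B)
  have u_ge: "x \<bullet> G y \<le> u x" for x y
    unfolding u_def using assms G_in by (intro Max_ge) auto
  have u_eq: "x \<bullet> G x = u x" for x
  proof (rule antisym[OF u_ge])
    show "u x \<le> x \<bullet> G x"
      unfolding u_def using assms least[of x]
      by (subst Max_le_iff) (auto simp: B is_max_def G_def)
  qed
  have mono: "(G x - G y) \<bullet> (x - y) \<ge> 0" for x y
    using u_ge[of x y] u_ge[of y x] u_eq[of x] u_eq[of y]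
    by (simp add: inner_diff_left inner_diff_right inner_commute)
  obtain M where M: "\<And>x. norm (G x) \<le> M"
  proof -
    have "bounded B" using assms finite_imp_bounded by blast
    then show ?thesis using that G_in by (auto simp: bounded_iff)
  qed
  have meas: "(\<lambda>t. G (p + t *\<^sub>R e)) \<in> borel_measurable borel" for p e
  proof -
    have [measurable]: "Measurable.pred borel (\<lambda>t. is_max (p + t *\<^sub>R e) i)" for i
      unfolding is_max_def by measurable
    show ?thesis unfolding G_def by measurable
  qed
  have int: "(\<lambda>t. G (p + t *\<^sub>R e)) integrable_on {x..y}" for p e x y
  proof (rule measurable_bounded_by_integrable_imp_integrable[where g = "\<lambda>_. M"])
    show "(\<lambda>t. G (p + t *\<^sub>R e)) \<in> borel_measurable (lebesgue_on {x..y})"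
      using meas by (intro measurable_restrict_space1 measurable_completion) simp
  qed (auto simp: M)
  define C where "C p q = integral {0..1} (\<lambda>t. G (p + t *\<^sub>R (q - p)))" for p q
  have Cd: "C p q \<bullet> d = integral {0..1} (\<lambda>t. G (p + t *\<^sub>R (q - p)) \<bullet> d)" for p q d
    unfolding C_def using int
    by (subst integral_linear[OF _ bounded_linear_inner_left, symmetric]) (auto simp: o_def)
  have intd: "(\<lambda>t. G (p + t *\<^sub>R e) \<bullet> d) integrable_on {x..y}" for p e d x y
    using integrable_linear[OF int bounded_linear_inner_left] by (simp add: o_def)
  show ?thesis
  proof
    show "C p q = C q p" for p q
    proof -
      have eq: "q + (1 - t) *\<^sub>R (p - q) = p + t *\<^sub>R (q - p)" for t
        by (simp add: algebra_simps)
      have "((\<lambda>t. G (q + t *\<^sub>R (p - q))) has_integral C q p) (cbox 0 1)"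
        unfolding C_def using int by (simp add: integrable_integral)
      from has_integral_affinity[OF this, of "-1" 1]
      have "((\<lambda>t. G (q + (1 - t) *\<^sub>R (p - q))) has_integral C q p) {0..1}"
        by (simp add: image_iff)
      then show ?thesis unfolding eq by (simp add: C_def integral_unique)
    qed
    show "C p q \<bullet> (q - p) = Max ((\<bullet>) q ` B) - Max ((\<bullet>) p ` B)" for p q
    proof -
      have "G (p + s *\<^sub>R (q - p)) \<bullet> (q - p) * (t - s)
          \<le> u (p + t *\<^sub>R (q - p)) - u (p + s *\<^sub>R (q - p))" for s t
        using u_ge[of "p + t *\<^sub>R (q - p)" "p + s *\<^sub>R (q - p)"] u_eq[of "p + s *\<^sub>R (q - p)"]
        by (simp add: algebra_simps inner_add_left inner_add_right inner_diff_left
            inner_diff_right inner_commute)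
      from integral_of_subgradient[OF this intd]
      show ?thesis unfolding Cd by (simp add: u_def)
    qed
    show "(C p c - C p d) \<bullet> (c - d) \<ge> 0" for p c d
    proof -
      let ?k = "\<lambda>t. G (p + t *\<^sub>R (c - p)) \<bullet> (c - d) - G (p + t *\<^sub>R (d - p)) \<bullet> (c - d)"
      \<comment> \<open>At parameter \<open>t\<close> the two segments issuing from \<open>p\<close>
        are \<open>t *\<^sub>R (c - d)\<close> apart, so monotonicity of \<open>G\<close> carries a
        factor \<open>t\<close> that can be cancelled.\<close>
      have pos: "?k t \<ge> 0" if "t > 0" for t
      proof -
        have "0 \<le> t * ?k t"
          using mono[of "p + t *\<^sub>R (c - p)" "p + t *\<^sub>R (d - p)"]
          by (simp add: inner_diff_left inner_diff_right algebra_simps)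
        then show ?thesis using that by (simp add: zero_le_mult_iff)
      qed
      have "(C p c - C p d) \<bullet> (c - d) = integral {0..1} ?k"
        using intd by (simp add: inner_diff_left Cd integral_diff)
      also have "\<dots> = integral {0..1} (\<lambda>t. if t = 0 then 0 else ?k t)"
        by (rule integral_spike[of "{0}"]) auto
      also have "\<dots> \<ge> 0"
      proof (rule integral_nonneg)
        show "(\<lambda>t. if t = 0 then 0 else ?k t) integrable_on {0..1}"
          by (rule integrable_spike[of ?k _ "{0}"]) (auto intro!: integrable_diff intd)
      qed (use pos in auto)
      finally show ?thesis .
    qed
    show "C p q = m *\<^sub>R C p (p + m *\<^sub>R (q - p)) + (1 - m) *\<^sub>R C (p + m *\<^sub>R (q - p)) q"
      if m: "0 \<le> m" "m \<le> 1" for p q m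
    proof (cases "m = 0 \<or> m = 1")
      case False
      with m have m: "0 < m" "m < 1" by auto
      define e c where "e = q - p" and "c = p + m *\<^sub>R (q - p)"
      let ?F = "\<lambda>t. G (p + t *\<^sub>R e)"
      have 1: "(?F has_integral integral {0..m} ?F) (cbox 0 m)"
        and 2: "(?F has_integral integral {m..1} ?F) (cbox m 1)"
        using int by (auto simp: integrable_integral)
      have "C p c = integral {0..m} ?F /\<^sub>R m"
        using has_integral_affinity'[OF 1 m(1), of 0] m
        by (simp add: C_def c_def e_def integral_unique mult.commute)
      moreover have "c + t *\<^sub>R (q - c) = p + ((1 - m) * t + m) *\<^sub>R e" for t
        by (simp add: c_def e_def algebra_simps)
      then have "C c q = integral {m..1} ?F /\<^sub>R (1 - m)"
        using has_integral_affinity'[OF 2, of "1 - m" m] m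
        by (simp add: C_def integral_unique)
      moreover have "C p q = integral {0..m} ?F + integral {m..1} ?F"
        unfolding C_def e_def[symmetric]
        using m int by (intro Henstock_Kurzweil_Integration.integral_combine[symmetric]) auto
      ultimately show ?thesis using m by (simp flip: c_def)
    qed auto
  qed
qed

text \<open>The finitely many strict inequalities leave room for a small quadratic: the values
  \<open>h i - \<eta> * (norm (p i))\<^sup>2\<close> still come from a maximum of linear functions.
  Adding the quadratic back restores \<open>h\<close> and makes the monotonicity of \<open>C\<close>
  strong.\<close>

lemma strong_mean_subgradient_exists:
  fixes p b :: "'i \<Rightarrow> 'a::euclidean_space" and h :: "'i \<Rightarrow> real" and a :: 'a
  assumes I: "finite I" "I \<noteq> {}"
    and chart: "\<And>i. i \<in> I \<Longrightarrow> a \<bullet> p i = 1"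
    and touch: "\<And>i. i \<in> I \<Longrightarrow> b i \<bullet> p i = h i"
    and below: "\<And>i j. i \<in> I \<Longrightarrow> j \<in> I \<Longrightarrow> i \<noteq> j \<Longrightarrow> b i \<bullet> p j < h j"
  obtains C :: "'a \<Rightarrow> 'a \<Rightarrow> 'a" and \<eta> :: real where
    "\<eta> > 0"
    "\<And>x y. C x y = C y x"
    "\<And>i j. i \<in> I \<Longrightarrow> j \<in> I \<Longrightarrow> C (p i) (p j) \<bullet> (p j - p i) = h j - h i"
    "\<And>x c d. (C x c - C x d) \<bullet> (c - d) \<ge> \<eta> * (norm (c - d))\<^sup>2"
    "\<And>x y m. 0 \<le> m \<Longrightarrow> m \<le> 1 \<Longrightarrow>
       C x y = m *\<^sub>R C x (x + m *\<^sub>R (y - x)) + (1 - m) *\<^sub>R C (x + m *\<^sub>R (y - x)) y"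
proof -
  have "\<forall>\<^sub>F \<eta> in at_right 0. \<forall>i\<in>I. \<forall>j\<in>I. i \<noteq> j \<longrightarrow> \<eta> * (norm (p i - p j))\<^sup>2 < h j - b i \<bullet> p j"
  proof (intro eventually_ball_finite I ballI)
    fix i j assume ij: "i \<in> I" "j \<in> I"
    have "((\<lambda>\<eta>. \<eta> * (norm (p i - p j))\<^sup>2) \<longlongrightarrow> 0 * (norm (p i - p j))\<^sup>2) (at_right 0)"
      by (intro tendsto_intros)
    then have "\<forall>\<^sub>F \<eta> in at_right 0. \<eta> * (norm (p i - p j))\<^sup>2 < h j - b i \<bullet> p j" if "i \<noteq> j"
      using below[OF ij that] by (auto intro: order_tendstoD(2))
    then show "\<forall>\<^sub>F \<eta> in at_right 0. i \<noteq> j \<longrightarrow> \<eta> * (norm (p i - p j))\<^sup>2 < h j - b i \<bullet> p j"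
      by (cases "i = j") auto
  qed
  then have "\<forall>\<^sub>F \<eta> in at_right 0. \<eta> > 0 \<and>
      (\<forall>i\<in>I. \<forall>j\<in>I. i \<noteq> j \<longrightarrow> \<eta> * (norm (p i - p j))\<^sup>2 < h j - b i \<bullet> p j)"
    by (intro eventually_conj eventually_at_right_less)
  from eventually_happens'[OF trivial_limit_at_right_real this]
  obtain \<eta> :: real where \<eta>: "\<eta> > 0"
    and small: "\<And>i j. i \<in> I \<Longrightarrow> j \<in> I \<Longrightarrow> i \<noteq> j \<Longrightarrow> \<eta> * (norm (p i - p j))\<^sup>2 < h j - b i \<bullet> p j"
    by blast
  \<comment> \<open>the affine functions touching \<open>h - \<eta> * (norm p)\<^sup>2\<close> from below, made linear by the chart \<open>a\<close>\<close>
  define b' where "b' i = b i - (2 * \<eta>) *\<^sub>R p i + (\<eta> * (p i \<bullet> p i)) *\<^sub>R a" for i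
  define B where "B = b' ` I"
  have B: "finite B" "B \<noteq> {}" using I by (auto simp: B_def)
  have max: "Max ((\<bullet>) (p j) ` B) = h j - \<eta> * (p j \<bullet> p j)" if j: "j \<in> I" for j
  proof (rule Max_eqI)
    show "finite ((\<bullet>) (p j) ` B)" using B by simp
    have *: "p j \<bullet> b' i = b i \<bullet> p j + \<eta> * (norm (p i - p j))\<^sup>2 - \<eta> * (p j \<bullet> p j)" for i
      using chart[OF j]
      by (simp add: b'_def power2_norm_eq_inner inner_add_right inner_diff_left inner_diff_right
          inner_commute algebra_simps)
    show "y \<le> h j - \<eta> * (p j \<bullet> p j)" if y: "y \<in> (\<bullet>) (p j) ` B" for y
    proof -
      obtain i where i: "i \<in> I" "y = p j \<bullet> b' i" using y by (auto simp: B_def)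
      show ?thesis
      proof (cases "i = j")
        case True
        then show ?thesis using i touch[OF j] by (simp add: *)
      next
        case False
        then show ?thesis using i small[OF i(1) j] by (simp add: *)
      qed
    qed
    have "h j - \<eta> * (p j \<bullet> p j) = p j \<bullet> b' j" using touch[OF j] by (simp add: *)
    then show "h j - \<eta> * (p j \<bullet> p j) \<in> (\<bullet>) (p j) ` B" using j by (auto simp: B_def)
  qed
  obtain C :: "'a \<Rightarrow> 'a \<Rightarrow> 'a" where
    C: "\<And>p q. C p q = C q p"
    "\<And>p q. C p q \<bullet> (q - p) = Max ((\<bullet>) q ` B) - Max ((\<bullet>) p ` B)"
    "\<And>p c d. (C p c - C p d) \<bullet> (c - d) \<ge> 0"
    "\<And>p q m. 0 \<le> m \<Longrightarrow> m \<le> 1 \<Longrightarrow>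
       C p q = m *\<^sub>R C p (p + m *\<^sub>R (q - p)) + (1 - m) *\<^sub>R C (p + m *\<^sub>R (q - p)) q"
    by (rule mean_subgradient_exists[OF B], rule that)
  show ?thesis
  proof
    show "\<eta> > 0" by fact
    \<comment> \<open>The added term is the mean over the segment of the gradient
      \<open>(2 * \<eta>) *\<^sub>R z\<close> of \<open>\<eta> * (norm z)\<^sup>2\<close>.\<close>
    let ?C = "\<lambda>x y. C x y + \<eta> *\<^sub>R (x + y)"
    show "?C x y = ?C y x" for x y using C(1)[of x y] by (simp add: add.commute)
    show "?C (p i) (p j) \<bullet> (p j - p i) = h j - h i" if "i \<in> I" "j \<in> I" for i j
      using C(2)[of "p i" "p j"] unfolding max[OF that(1)] max[OF that(2)]
      by (simp add: inner_add_left inner_diff_right inner_commute algebra_simps)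
    show "(?C x c - ?C x d) \<bullet> (c - d) \<ge> \<eta> * (norm (c - d))\<^sup>2" for x c d
    proof -
      have "(?C x c - ?C x d) \<bullet> (c - d) = (C x c - C x d) \<bullet> (c - d) + \<eta> * (norm (c - d))\<^sup>2"
        by (simp add: power2_norm_eq_inner inner_add_left inner_diff_left algebra_simps)
      then show ?thesis using C(3) by simp
    qed
    show "?C x y = m *\<^sub>R ?C x (x + m *\<^sub>R (y - x)) + (1 - m) *\<^sub>R ?C (x + m *\<^sub>R (y - x)) y"
      if "0 \<le> m" "m \<le> 1" for x y m
      by (subst C(4)[OF that]) (simp add: algebra_simps)
  qed
qed

section \<open>Sign of the contribution of one triangle\<close>

text \<open>Each bracket compares the edge vector \<open>C\<close> with the affine interpolation of
  \<open>h\<close> on the triangle. The level line of \<open>g\<close> through \<open>p2\<close>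
  meets the side from \<open>p1\<close> to \<open>p3\<close> in a point \<open>c\<close>. In the
  direction of this line, monotonicity bounds \<open>C p1 c\<close> and \<open>C c p3\<close> below
  by \<open>C p1 p2\<close> and \<open>C p2 p3\<close>, and splitting reassembles the first two to
  \<open>C p3 p1\<close>.\<close>

lemma weighted_edge_sum_neg_sorted:
  fixes p1 p2 p3 :: "'a::real_inner" and C :: "'a \<Rightarrow> 'a \<Rightarrow> 'a"
  assumes g: "g1 \<le> g2" "g2 \<le> g3" "g1 < g3"
    and \<eta>: "\<eta> > 0"
    and C_sym: "\<And>x y. C x y = C y x"
    and C12: "C p1 p2 \<bullet> (p2 - p1) = h2 - h1"
    and C23: "C p2 p3 \<bullet> (p3 - p2) = h3 - h2"
    and C31: "C p3 p1 \<bullet> (p1 - p3) = h1 - h3"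
    and C_mono: "\<And>x c d. (C x c - C x d) \<bullet> (c - d) \<ge> \<eta> * (norm (c - d))\<^sup>2"
    and C_split: "\<And>x y m. 0 \<le> m \<Longrightarrow> m \<le> 1 \<Longrightarrow>
       C x y = m *\<^sub>R C x (x + m *\<^sub>R (y - x)) + (1 - m) *\<^sub>R C (x + m *\<^sub>R (y - x)) y"
    and nondeg: "\<And>m. p2 \<noteq> p1 + m *\<^sub>R (p3 - p1)"
  shows "(g1 - g2)\<^sup>2 * (C p1 p2 \<bullet> (p3 - p1) - (h3 - h1))
    + (g2 - g3)\<^sup>2 * (C p2 p3 \<bullet> (p1 - p2) - (h1 - h2))
    + (g3 - g1)\<^sup>2 * (C p3 p1 \<bullet> (p2 - p3) - (h2 - h3)) < 0"
proof -
  define \<Delta> m where "\<Delta> = g3 - g1" and "m = (g2 - g1) / (g3 - g1)"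
  have \<Delta>: "\<Delta> > 0" using g by (simp add: \<Delta>_def)
  have m: "0 \<le> m" "m \<le> 1" using g by (auto simp: m_def)
  have g12: "g2 - g1 = m * \<Delta>" using g by (simp add: m_def \<Delta>_def)
  then have g23: "g3 - g2 = (1 - m) * \<Delta>" by (simp add: \<Delta>_def algebra_simps)
  \<comment> \<open>\<open>d\<close> spans the level direction on the triangle of the affine function with values \<open>g1\<close>, \<open>g2\<close>, \<open>g3\<close>\<close>
  define c d where "c = p1 + m *\<^sub>R (p3 - p1)" and "d = c - p2"
  have "d \<noteq> 0" using nondeg[of m] by (auto simp: d_def c_def)
  have *: "C p1 c \<bullet> d \<ge> C p1 p2 \<bullet> d + \<eta> * (norm d)\<^sup>2"
    "C c p3 \<bullet> d \<ge> C p2 p3 \<bullet> d + \<eta> * (norm d)\<^sup>2"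
    using C_mono[where x = p1 and c = c and d = p2] C_mono[where x = p3 and c = c and d = p2] C_sym[of c p3] C_sym[of p2 p3]
    by (auto simp: d_def inner_diff_left)
  have "m * (C p1 p2 \<bullet> d + \<eta> * (norm d)\<^sup>2) + (1 - m) * (C p2 p3 \<bullet> d + \<eta> * (norm d)\<^sup>2)
      \<le> m * (C p1 c \<bullet> d) + (1 - m) * (C c p3 \<bullet> d)"
    using m * by (intro add_mono mult_left_mono) auto
  also have "\<dots> = C p3 p1 \<bullet> d"
    using C_split[OF m, of p1 p3] C_sym[of p3 p1] by (simp add: c_def inner_add_left)
  finally have main: "m * (C p1 p2 \<bullet> d) + (1 - m) * (C p2 p3 \<bullet> d) + \<eta> * (norm d)\<^sup>2
      \<le> C p3 p1 \<bullet> d"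
    by (simp add: algebra_simps)
  define A B E where "A = C p1 p2 \<bullet> (p3 - p1)" and "B = C p2 p3 \<bullet> (p1 - p2)"
    and "E = C p3 p1 \<bullet> (p2 - p3)"
  \<comment> \<open>Written along each side in turn, \<open>d\<close> turns the inequality
    \<open>main\<close> into the claim divided by \<open>\<Delta>\<^sup>2\<close>; the parts of
    \<open>d\<close> along a side are evaluated by the prescribed increments of
    \<open>h\<close>.\<close>
  have "d = m *\<^sub>R (p3 - p1) - (p2 - p1)" by (simp add: d_def c_def)
  then have dA: "C p1 p2 \<bullet> d = m * A - (h2 - h1)"
    using C12 by (simp add: A_def inner_diff_right)
  have "d = (1 - m) *\<^sub>R (p1 - p2) + m *\<^sub>R (p3 - p2)" by (simp add: d_def c_def algebra_simps)
  then have dB: "C p2 p3 \<bullet> d = (1 - m) * B + m * (h3 - h2)"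
    using C23 by (simp add: B_def inner_add_right)
  have "d = (1 - m) *\<^sub>R (p1 - p3) - (p2 - p3)" by (simp add: d_def c_def algebra_simps)
  then have dE: "C p3 p1 \<bullet> d = (1 - m) * (h1 - h3) - E"
    using C31 by (simp add: E_def inner_diff_right)
  have "m\<^sup>2 * (A - (h3 - h1)) + (1 - m)\<^sup>2 * (B - (h1 - h2)) + (E - (h2 - h3)) \<le> - (\<eta> * (norm d)\<^sup>2)"
    using main unfolding dA dB dE by (simp add: power2_eq_square algebra_simps)
  also have "\<dots> < 0" using \<eta> \<open>d \<noteq> 0\<close> by simp
  finally have neg: "m\<^sup>2 * (A - (h3 - h1)) + (1 - m)\<^sup>2 * (B - (h1 - h2)) + (E - (h2 - h3)) < 0" .
  have "(g1 - g2)\<^sup>2 = m\<^sup>2 * \<Delta>\<^sup>2" "(g2 - g3)\<^sup>2 = (1 - m)\<^sup>2 * \<Delta>\<^sup>2" "(g3 - g1)\<^sup>2 = \<Delta>\<^sup>2"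
    using g12 g23 by (metis power2_commute power_mult_distrib, metis power2_commute power_mult_distrib, simp add: \<Delta>_def)
  then have "(g1 - g2)\<^sup>2 * (A - (h3 - h1)) + (g2 - g3)\<^sup>2 * (B - (h1 - h2))
      + (g3 - g1)\<^sup>2 * (E - (h2 - h3))
    = \<Delta>\<^sup>2 * (m\<^sup>2 * (A - (h3 - h1)) + (1 - m)\<^sup>2 * (B - (h1 - h2)) + (E - (h2 - h3)))"
    by (simp only: algebra_simps)
  also have "\<dots> < 0" using neg \<Delta> by (simp add: mult_less_0_iff)
  finally show ?thesis by (simp add: A_def B_def E_def)
qed

lemma weighted_edge_sum_neg:
  fixes p1 p2 p3 :: "real^3" and C :: "real^3 \<Rightarrow> real^3 \<Rightarrow> real^3"
  assumes ne: "\<not> (g1 = g2 \<and> g2 = g3)"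
    and \<eta>: "\<eta> > 0"
    and C_sym: "\<And>x y. C x y = C y x"
    and C12: "C p1 p2 \<bullet> (p2 - p1) = h2 - h1"
    and C23: "C p2 p3 \<bullet> (p3 - p2) = h3 - h2"
    and C31: "C p3 p1 \<bullet> (p1 - p3) = h1 - h3"
    and C_mono: "\<And>x c d. (C x c - C x d) \<bullet> (c - d) \<ge> \<eta> * (norm (c - d))\<^sup>2"
    and C_split: "\<And>x y m. 0 \<le> m \<Longrightarrow> m \<le> 1 \<Longrightarrow>
       C x y = m *\<^sub>R C x (x + m *\<^sub>R (y - x)) + (1 - m) *\<^sub>R C (x + m *\<^sub>R (y - x)) y"
    and det: "cross3 p1 p2 \<bullet> p3 \<noteq> 0"
  shows "(g1 - g2)\<^sup>2 * (C p1 p2 \<bullet> (p3 - p1) - (h3 - h1))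
    + (g2 - g3)\<^sup>2 * (C p2 p3 \<bullet> (p1 - p2) - (h1 - h2))
    + (g3 - g1)\<^sup>2 * (C p3 p1 \<bullet> (p2 - p3) - (h2 - h3)) < 0"
proof -
  have nd: "y \<noteq> x + m *\<^sub>R (z - x)" if "cross3 x y \<bullet> z \<noteq> 0" for x y z :: "real^3" and m
  proof
    assume "y = x + m *\<^sub>R (z - x)"
    then have "cross3 x y \<bullet> z = 0"
      by (simp only:) (simp add: cross3_simps)
    with that show False by simp
  qed
  have dets: "cross3 p2 p3 \<bullet> p1 \<noteq> 0" "cross3 p3 p1 \<bullet> p2 \<noteq> 0"
    "cross3 p2 p1 \<bullet> p3 \<noteq> 0" "cross3 p1 p3 \<bullet> p2 \<noteq> 0" "cross3 p3 p2 \<bullet> p1 \<noteq> 0"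
    using det by (auto simp: cross3_simps)
  have C21: "C p2 p1 \<bullet> (p1 - p2) = h1 - h2" and C32: "C p3 p2 \<bullet> (p2 - p3) = h2 - h3"
    and C13: "C p1 p3 \<bullet> (p3 - p1) = h3 - h1"
    using C12 C23 C31 by (simp_all add: C_sym[of p2 p1] C_sym[of p3 p2] C_sym[of p1 p3] inner_diff_right)
  \<comment> \<open>A bracket is the same from either end of its edge, because \<open>C\<close> has
    the increment of \<open>h\<close> along it. Hence reversed orders of the vertices are instances
    of the sorted case as well.\<close>
  have e: "C p1 p2 \<bullet> (p3 - p1) - (h3 - h1) = C p2 p1 \<bullet> (p3 - p2) - (h3 - h2)"
    "C p2 p3 \<bullet> (p1 - p2) - (h1 - h2) = C p3 p2 \<bullet> (p1 - p3) - (h1 - h3)"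
    "C p3 p1 \<bullet> (p2 - p3) - (h2 - h3) = C p1 p3 \<bullet> (p2 - p1) - (h2 - h1)"
    using C12 C23 C31 by (simp_all add: C_sym[of p2 p1] C_sym[of p3 p2] C_sym[of p1 p3] inner_diff_right)
  note s = weighted_edge_sum_neg_sorted[where C = C and \<eta> = \<eta>, OF _ _ _ \<eta> C_sym _ _ _ C_mono C_split]
  consider "g1 \<le> g2" "g2 \<le> g3" "g1 < g3" | "g2 \<le> g3" "g3 \<le> g1" "g2 < g1"
    | "g3 \<le> g1" "g1 \<le> g2" "g3 < g2" | "g2 \<le> g1" "g1 \<le> g3" "g2 < g3"
    | "g1 \<le> g3" "g3 \<le> g2" "g1 < g2" | "g3 \<le> g2" "g2 \<le> g1" "g3 < g1"
    using ne by linarith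
  then show ?thesis
  proof cases
    case 1
    from s[OF this C12 C23 C31 _ _ nd[OF det]] show ?thesis by simp
  next
    case 2
    from s[OF this C23 C31 C12 _ _ nd[OF dets(1)]] show ?thesis by simp
  next
    case 3
    from s[OF this C31 C12 C23 _ _ nd[OF dets(2)]] show ?thesis by simp
  next
    case 4
    from s[OF this C21 C13 C32 _ _ nd[OF dets(3)]] show ?thesis
      unfolding e by (simp add: power2_commute)
  next
    case 5
    from s[OF this C13 C32 C21 _ _ nd[OF dets(4)]] show ?thesis
      unfolding e by (simp add: power2_commute)
  next
    case 6
    from s[OF this C32 C21 C13 _ _ nd[OF dets(5)]] show ?thesis
      unfolding e by (simp add: power2_commute)
  qed
qed

subsection \<open>Vanishing of the radial stretches\<close>

text \<open>By cyclic invariance of \<open>T\<close> the sum is three times that of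
  \<open>F\<close>, which vanishes when grouped by the oriented edge \<open>(i, j)\<close>.\<close>

lemma sum_triples_cyclic_cancel:
  fixes F :: "'i \<Rightarrow> 'i \<Rightarrow> 'i \<Rightarrow> 'b::comm_monoid_add"
  assumes fin: "finite T"
    and cyc: "\<And>i j k. (i, j, k) \<in> T \<Longrightarrow> (j, k, i) \<in> T"
    and cancel: "\<And>i j. (\<Sum>k | (i, j, k) \<in> T. F i j k) = 0"
  shows "(\<Sum>(i, j, k)\<in>T. F i j k + F j k i + F k i j) = 0"
proof -
  have 0: "(\<Sum>(i, j, k)\<in>T. F i j k) = 0"
  proof -
    define e :: "'i \<times> 'i \<times> 'i \<Rightarrow> 'i \<times> 'i" where "e = (\<lambda>(i, j, k). (i, j))"
    have "(\<Sum>(i, j, k)\<in>T. F i j k) = (\<Sum>y\<in>e ` T. \<Sum>x\<in>{x \<in> T. e x = y}. (\<lambda>(i, j, k). F i j k) x)"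
      by (rule sum.image_gen[OF fin])
    also have "\<dots> = 0"
    proof (rule sum.neutral, rule ballI)
      fix y :: "'i \<times> 'i"
      obtain i j where y: "y = (i, j)" by fastforce
      have "(\<Sum>x\<in>{x \<in> T. e x = y}. (\<lambda>(i, j, k). F i j k) x) = (\<Sum>k | (i, j, k) \<in> T. F i j k)"
        by (rule sum.reindex_bij_witness[of _ "\<lambda>k. (i, j, k)" "\<lambda>(i, j, k). k"])
          (auto simp: e_def y)
      then show "(\<Sum>x\<in>{x \<in> T. e x = y}. (\<lambda>(i, j, k). F i j k) x) = 0"
        using cancel by simp
    qed
    finally show ?thesis .
  qed
  have "(\<Sum>(i, j, k)\<in>T. F j k i) = (\<Sum>(i, j, k)\<in>T. F i j k)"
    by (rule sum.reindex_bij_witness[of _ "\<lambda>(i, j, k). (k, i, j)" "\<lambda>(i, j, k). (j, k, i)"])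
      (auto dest: cyc)
  moreover have "(\<Sum>(i, j, k)\<in>T. F k i j) = (\<Sum>(i, j, k)\<in>T. F i j k)"
    by (rule sum.reindex_bij_witness[of _ "\<lambda>(i, j, k). (j, k, i)" "\<lambda>(i, j, k). (k, i, j)"])
      (auto dest: cyc)
  ultimately show ?thesis
    using 0 by (simp add: sum.distrib case_prod_beta)
qed

lemma cramer3:
  fixes x y z w :: "real^3"
  assumes "cross3 x y \<bullet> z \<noteq> 0"
  shows "w = ((cross3 y z \<bullet> w) / (cross3 x y \<bullet> z)) *\<^sub>R x + ((cross3 z x \<bullet> w) / (cross3 x y \<bullet> z)) *\<^sub>R y
    + ((cross3 x y \<bullet> w) / (cross3 x y \<bullet> z)) *\<^sub>R z"
proof -
  have "(cross3 x y \<bullet> z) *\<^sub>R w = (cross3 y z \<bullet> w) *\<^sub>R x + (cross3 z x \<bullet> w) *\<^sub>R y + (cross3 x y \<bullet> w) *\<^sub>R z"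
    by (simp add: cross3_simps forall_3)
  then have "inverse (cross3 x y \<bullet> z) *\<^sub>R ((cross3 x y \<bullet> z) *\<^sub>R w)
    = inverse (cross3 x y \<bullet> z) *\<^sub>R ((cross3 y z \<bullet> w) *\<^sub>R x + (cross3 z x \<bullet> w) *\<^sub>R y + (cross3 x y \<bullet> w) *\<^sub>R z)"
    by simp
  then show ?thesis using assms by (simp add: scaleR_add_right divide_inverse mult.commute)
qed

text \<open>Here \<open>q i\<close> stands for the deformation vector at a link vertex relative to
  that of \<open>v0\<close>, scaled by \<open>h i\<close> like \<open>p i\<close>;
  \<open>q_edge\<close> is then the first-order length condition on a link edge. \<open>T\<close>
  lists every triangle in all its orders. In \<open>adjacent\<close>, the first alternative serves
  edges that may have a triangle on one side only.\<close>

lemma no_radial_stretch: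
  fixes p b q :: "'i \<Rightarrow> real^3" and g h :: "'i \<Rightarrow> real" and a :: "real^3"
    and T :: "('i \<times> 'i \<times> 'i) set"
  assumes I: "finite I" "T \<subseteq> I \<times> I \<times> I"
    and cyc: "\<And>i j k. (i, j, k) \<in> T \<Longrightarrow> (j, k, i) \<in> T"
    and swap: "\<And>i j k. (i, j, k) \<in> T \<Longrightarrow> (j, i, k) \<in> T"
    and det: "\<And>i j k. (i, j, k) \<in> T \<Longrightarrow> cross3 (p i) (p j) \<bullet> p k \<noteq> 0"
    and adjacent: "\<And>i j k. (i, j, k) \<in> T \<Longrightarrow> g i = 0 \<and> g j = 0 \<or>
       (\<exists>k'. {l. (i, j, l) \<in> T} = {k, k'} \<and>
         (cross3 (p i) (p j) \<bullet> p k) * (cross3 (p i) (p j) \<bullet> p k') < 0)"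
    and chart: "\<And>i. i \<in> I \<Longrightarrow> a \<bullet> p i = 1"
    and touch: "\<And>i. i \<in> I \<Longrightarrow> b i \<bullet> p i = h i"
    and below: "\<And>i j. i \<in> I \<Longrightarrow> j \<in> I \<Longrightarrow> i \<noteq> j \<Longrightarrow> b i \<bullet> p j < h j"
    and q_vertex: "\<And>i. i \<in> I \<Longrightarrow> q i \<bullet> p i = g i * h i"
    and q_edge: "\<And>i j k. (i, j, k) \<in> T \<Longrightarrow> q i \<bullet> p j + q j \<bullet> p i = g i * h j + g j * h i"
    and ijk: "(i0, j0, k0) \<in> T"
  shows "g i0 = 0"
proof -
  have fin: "finite T" using I finite_subset by blast
  have T_I: "i \<in> I" "j \<in> I" "k \<in> I" if "(i, j, k) \<in> T" for i j k using I(2) that by auto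
  obtain C :: "real^3 \<Rightarrow> real^3 \<Rightarrow> real^3" and \<eta> :: real where \<eta>: "\<eta> > 0"
    and C_sym: "\<And>x y. C x y = C y x"
    and C_h: "\<And>i j. i \<in> I \<Longrightarrow> j \<in> I \<Longrightarrow> C (p i) (p j) \<bullet> (p j - p i) = h j - h i"
    and C_mono: "\<And>x c d. (C x c - C x d) \<bullet> (c - d) \<ge> \<eta> * (norm (c - d))\<^sup>2"
    and C_split: "\<And>x y m. 0 \<le> m \<Longrightarrow> m \<le> 1 \<Longrightarrow>
       C x y = m *\<^sub>R C x (x + m *\<^sub>R (y - x)) + (1 - m) *\<^sub>R C (x + m *\<^sub>R (y - x)) y"
  proof (rule strong_mean_subgradient_exists[OF I(1) _ chart touch below])
    show "I \<noteq> {}" using T_I[OF ijk] by auto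
  qed (auto intro: that)
  define D where "D i j k = cross3 (p i) (p j) \<bullet> p k" for i j k
  define r where "r i j = q i \<bullet> p j - g i * h j" for i j
  have D_cyc: "D j k i = D i j k" "D k i j = D i j k" for i j k
    by (simp_all add: D_def cross3_simps)
  have r_skew: "r j i = - r i j" if "(i, j, k) \<in> T" for i j k
    using q_edge[OF that] by (simp add: r_def)
  \<comment> \<open>The bend of \<open>h\<close> over a triangle relative to the edge gradient \<open>C\<close>; the second summand is the
    normalised value of the skew form \<open>\<langle>A x, y\<rangle> - g x * h y\<close> on the triangle, where \<open>A\<close> is the linear
    extension of \<open>q\<close>. It cancels in cyclic sums and makes \<open>F\<close> antisymmetric across a common edge.\<close>
  define X where "X i j k = (g i - g j)\<^sup>2 * (C (p i) (p j) \<bullet> (p k - p i) - (h k - h i))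
      - (g j - g i) * (r i j + r j k + r k i)" for i j k
  define F where "F i j k = X i j k / \<bar>D i j k\<bar>" for i j k
  \<comment> \<open>signed areas of the triangles spanned by the edges and the foot of \<open>a\<close>\<close>
  define G where "G i j k = sgn (D i j k) * (g i * g j * (cross3 (p i) (p j) \<bullet> a))" for i j k

  \<comment> \<open>\<open>x\<close>, \<open>y\<close>, \<open>z\<close> are barycentric coordinates
    in the chart; \<open>z\<close> is a ratio of oriented areas and is negative across an
    edge.\<close>
  have bary: "\<exists>x y z. p k' = x *\<^sub>R p i + y *\<^sub>R p j + z *\<^sub>R p k \<and> x + y + z = 1 \<and> D i j k' = z * D i j k"
    if "(i, j, k) \<in> T" "k' \<in> I" for i j k k'
  proof -
    define x y z where "x = (cross3 (p j) (p k) \<bullet> p k') / D i j k"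
      and "y = (cross3 (p k) (p i) \<bullet> p k') / D i j k"
      and "z = (cross3 (p i) (p j) \<bullet> p k') / D i j k"
    have e: "p k' = x *\<^sub>R p i + y *\<^sub>R p j + z *\<^sub>R p k"
      unfolding x_def y_def z_def D_def by (rule cramer3[OF det[OF that(1)]])
    moreover from arg_cong[OF e, of "\<lambda>v. a \<bullet> v"] have "x + y + z = 1"
      using chart that T_I[OF that(1)] by (simp add: inner_add_right)
    moreover have "D i j k' = z * D i j k" using det[OF that(1)] by (simp add: z_def D_def)
    ultimately show ?thesis by blast
  qed

  have X_adj: "X i j k' * D i j k = X i j k * D i j k'" if t: "(i, j, k) \<in> T" "(i, j, k') \<in> T" for i j k k'
  proof -
    have in_I: "i \<in> I" "j \<in> I" "k' \<in> I" using T_I[OF t(1)] T_I[OF t(2)] by auto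
    obtain x y z where e: "p k' = x *\<^sub>R p i + y *\<^sub>R p j + z *\<^sub>R p k"
      and s: "x + y + z = 1" and z: "D i j k' = z * D i j k"
      using bary[OF t(1) in_I(3)] by blast
    \<comment> \<open>the bend of \<open>h\<close> along the edge \<open>ij\<close>\<close>
    define l where "l = h k' - (x * h i + y * h j + z * h k)"
    have hk: "h k' = x * h i + y * h j + z * h k + l" by (simp add: l_def)
    have x: "x = 1 - y - z" using s by simp
    have "r j k' = x * r j i + z * r j k - g j * l"
      using q_vertex[OF in_I(2)]
      by (simp add: r_def e hk inner_add_right algebra_simps)
    moreover have "r i k' = y * r i j + z * r i k - g i * l"
      using q_vertex[OF in_I(1)]
      by (simp add: r_def e hk inner_add_right algebra_simps)
    moreover have "r j i = - r i j" "r k i = - r i k" "r k' i = - r i k'"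
      using r_skew[OF t(1)] r_skew[OF swap[OF cyc[OF cyc[OF t(1)]]]]
        r_skew[OF swap[OF cyc[OF cyc[OF t(2)]]]] by auto
    ultimately have R: "r i j + r j k' + r k' i = z * (r i j + r j k + r k i) + l * (g i - g j)"
      by (simp add: x algebra_simps)
    have "p k' - p i = y *\<^sub>R (p j - p i) + z *\<^sub>R (p k - p i)"
      by (simp add: e x algebra_simps)
    then have "C (p i) (p j) \<bullet> (p k' - p i) = y * (h j - h i) + z * (C (p i) (p j) \<bullet> (p k - p i))"
      using C_h[OF in_I(1,2)] by (simp add: inner_add_right)
    then have Ch: "C (p i) (p j) \<bullet> (p k' - p i) - (h k' - h i)
        = z * (C (p i) (p j) \<bullet> (p k - p i) - (h k - h i)) - l"
      by (simp add: hk x algebra_simps)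
    \<comment> \<open>The bend \<open>l\<close> enters the first summand of \<open>X\<close> as
      \<open>- (g i - g j)\<^sup>2 * l\<close> and the second with the opposite sign, so only the
      area ratio \<open>z\<close> survives.\<close>
    have "X i j k' = z * X i j k"
      unfolding X_def Ch R by (simp add: algebra_simps power2_eq_square)
    then show ?thesis using z by simp
  qed

  have cancel: "(\<Sum>k | (i, j, k) \<in> T. H i j k) = 0"
    if zero: "\<And>i j k. g i = 0 \<Longrightarrow> g j = 0 \<Longrightarrow> H i j k = 0"
      and opp: "\<And>i j k k'. (i, j, k) \<in> T \<Longrightarrow> (i, j, k') \<in> T \<Longrightarrow> D i j k * D i j k' < 0 \<Longrightarrow>
        H i j k + H i j k' = 0"
    for H :: "'i \<Rightarrow> 'i \<Rightarrow> 'i \<Rightarrow> real" and i j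
  proof (cases "\<exists>k. (i, j, k) \<in> T")
    case True
    then obtain k where k: "(i, j, k) \<in> T" by blast
    from adjacent[OF k] show ?thesis
    proof
      assume "g i = 0 \<and> g j = 0"
      then show ?thesis by (simp add: zero)
    next
      assume "\<exists>k'. {l. (i, j, l) \<in> T} = {k, k'} \<and>
         (cross3 (p i) (p j) \<bullet> p k) * (cross3 (p i) (p j) \<bullet> p k') < 0"
      then obtain k' where k': "{l. (i, j, l) \<in> T} = {k, k'}" "D i j k * D i j k' < 0"
        unfolding D_def by blast
      then have "(i, j, k') \<in> T" "k \<noteq> k'" by (auto simp: mult_less_0_iff)
      then show ?thesis using k' opp[OF k] by simp
    qed
  qed simp

  have sumF: "(\<Sum>(i, j, k)\<in>T. F i j k + F j k i + F k i j) = 0"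
  proof (rule sum_triples_cyclic_cancel[OF fin cyc cancel])
    fix i j k k' assume t: "(i, j, k) \<in> T" "(i, j, k') \<in> T" and neg: "D i j k * D i j k' < 0"
    show "F i j k + F i j k' = 0"
      using neg X_adj[OF t] by (auto simp: F_def mult_less_0_iff field_simps)
  qed (auto simp: F_def X_def)
  have F_neg: "F i j k + F j k i + F k i j < 0" if t: "(i, j, k) \<in> T" "\<not> (g i = g j \<and> g j = g k)" for i j k
  proof -
    note in_I = T_I[OF t(1)]
    have "(g i - g j)\<^sup>2 * (C (p i) (p j) \<bullet> (p k - p i) - (h k - h i))
      + (g j - g k)\<^sup>2 * (C (p j) (p k) \<bullet> (p i - p j) - (h i - h j))
      + (g k - g i)\<^sup>2 * (C (p k) (p i) \<bullet> (p j - p k) - (h j - h k)) < 0"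
      using in_I by (intro weighted_edge_sum_neg[OF t(2) \<eta> C_sym C_h C_h C_h C_mono C_split] det t)
    then have "X i j k + X j k i + X k i j < 0"
      by (simp add: X_def algebra_simps)
    then have "(X i j k + X j k i + X k i j) / \<bar>D i j k\<bar> < 0"
      using det[OF t(1)] by (simp add: divide_less_0_iff D_def)
    then show ?thesis by (simp add: F_def D_cyc add_divide_distrib)
  qed
  have F_le: "F i j k + F j k i + F k i j \<le> 0" if "(i, j, k) \<in> T" for i j k
  proof (cases "g i = g j \<and> g j = g k")
    case True
    then show ?thesis by (simp add: F_def X_def)
  next
    case False
    then show ?thesis using F_neg[OF that] by simp
  qed
  have F0: "F i j k + F j k i + F k i j = 0" if "(i, j, k) \<in> T" for i j k
  proof -
    have "(\<Sum>(i, j, k)\<in>T. - (F i j k + F j k i + F k i j)) = 0"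
      using sumF by (simp add: case_prod_beta sum_negf del: minus_add_distrib)
    then have "\<forall>t\<in>T. (\<lambda>(i, j, k). - (F i j k + F j k i + F k i j)) t = 0"
      by (subst (asm) sum_nonneg_eq_0_iff[OF fin]) (use F_le in force)+
    with that show ?thesis by force
  qed
  have const: "g i = g j \<and> g j = g k" if "(i, j, k) \<in> T" for i j k
    using F_neg[OF that] F0[OF that] by fastforce

  have sumG: "(\<Sum>(i, j, k)\<in>T. G i j k + G j k i + G k i j) = 0"
  proof (rule sum_triples_cyclic_cancel[OF fin cyc cancel])
    fix i j k k' assume "D i j k * D i j k' < 0"
    then show "G i j k + G i j k' = 0"
      by (auto simp: G_def mult_less_0_iff)
  qed (auto simp: G_def)
  have G_eq: "G i j k + G j k i + G k i j = (g i)\<^sup>2 * \<bar>D i j k\<bar> * (a \<bullet> a)"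
    if t: "(i, j, k) \<in> T" for i j k
  proof -
    \<comment> \<open>Since the three vertices span the space and \<open>N\<close> takes on them the
      value \<open>D i j k\<close> where \<open>a\<close> takes 1, \<open>N\<close> is the multiple
      \<open>D i j k\<close> of \<open>a\<close>. So the three signed areas add up to that of the
      triangle.\<close>
    define N where "N = cross3 (p i) (p j) + cross3 (p j) (p k) + cross3 (p k) (p i)"
    have N: "N \<bullet> p i = D i j k" "N \<bullet> p j = D i j k" "N \<bullet> p k = D i j k"
      using D_cyc[of i j k] D_cyc[of j k i] by (simp_all add: N_def D_def inner_add_left dot_cross_self)
    obtain x y z where a: "a = x *\<^sub>R p i + y *\<^sub>R p j + z *\<^sub>R p k"
      using cramer3[OF det[OF t]] by blast
    have "a \<bullet> a = a \<bullet> (x *\<^sub>R p i + y *\<^sub>R p j + z *\<^sub>R p k)" using a by simp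
    also have "\<dots> = x + y + z" using chart T_I[OF t] by (simp add: inner_add_right)
    finally have aa: "a \<bullet> a = x + y + z" .
    have "N \<bullet> a = N \<bullet> (x *\<^sub>R p i + y *\<^sub>R p j + z *\<^sub>R p k)" using a by simp
    also have "\<dots> = D i j k * (a \<bullet> a)" by (simp add: inner_add_right N aa algebra_simps)
    finally have Na: "N \<bullet> a = D i j k * (a \<bullet> a)" .
    have "G i j k + G j k i + G k i j = sgn (D i j k) * (g i)\<^sup>2 * (N \<bullet> a)"
      using const[OF t]
      by (simp add: G_def D_cyc N_def inner_add_left power2_eq_square algebra_simps)
    also have "\<dots> = (g i)\<^sup>2 * (D i j k * sgn (D i j k)) * (a \<bullet> a)"
      by (simp add: Na)
    finally show ?thesis by (simp add: abs_sgn)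
  qed
  have "(g i)\<^sup>2 * \<bar>D i j k\<bar> * (a \<bullet> a) = 0" if "(i, j, k) \<in> T" for i j k
  proof -
    have "(\<Sum>t\<in>T. case t of (i, j, k) \<Rightarrow> (g i)\<^sup>2 * \<bar>D i j k\<bar> * (a \<bullet> a)) = 0"
      using sumG by (rule trans[rotated]) (auto intro!: sum.cong simp: G_eq)
    then have "\<forall>t\<in>T. (\<lambda>(i, j, k). (g i)\<^sup>2 * \<bar>D i j k\<bar> * (a \<bullet> a)) t = 0"
      by (subst (asm) sum_nonneg_eq_0_iff[OF fin]) auto
    with that show ?thesis by force
  qed
  from this[OF ijk] show ?thesis
    using det[OF ijk] chart[OF T_I(1)[OF ijk]] by (auto simp: D_def)
qed

subsection \<open>Triangulations by simplices with a common vertex\<close>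

lemma triple_product_nonzero:
  fixes o' x y z :: "real^3"
  assumes ind: "\<not> affine_dependent {o', x, y, z}" and dist: "distinct [o', x, y, z]"
  shows "cross3 (x - o') (y - o') \<bullet> (z - o') \<noteq> 0"
proof
  assume 0: "cross3 (x - o') (y - o') \<bullet> (z - o') = 0"
  let ?B = "{x - o', y - o', z - o'}"
  have "{u - o' |u. u \<in> {x, y, z}} = ?B" by auto
  then have indB: "independent ?B"
    using dependent_imp_affine_dependent[where S = "{x, y, z}" and a = o'] ind dist by auto
  have card: "card ?B = 3" using dist by simp
  have "UNIV \<subseteq> span ?B"
    using indB card by (intro card_ge_dim_independent) auto
  moreover have "?B \<subseteq> {w. cross3 (x - o') (y - o') \<bullet> w = 0}"
    using 0 by (auto simp: dot_cross_self)
  then have "span ?B \<subseteq> {w. cross3 (x - o') (y - o') \<bullet> w = 0}"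
    by (intro span_minimal subspace_hyperplane)
  ultimately have "cross3 (x - o') (y - o') \<bullet> cross3 (x - o') (y - o') = 0" by blast
  then have "cross3 (x - o') (y - o') = 0" by simp
  then obtain c where "y - o' = c *\<^sub>R (x - o')"
    using dist by (auto simp: cross_eq_0 collinear_lemma)
  then have "y - o' \<in> span {x - o'}" by (simp add: span_base span_scale)
  moreover have "independent (insert (y - o') {x - o'})" by (rule independent_mono[OF indB]) auto
  ultimately show False using dist by (auto simp: independent_insert split: if_splits)
qed

lemma interior_tetrahedron:
  fixes o' x y z :: "real^3"
  assumes "\<not> affine_dependent {o', x, y, z}" and "distinct [o', x, y, z]"
    and "\<alpha> > 0" "\<beta> > 0" "\<gamma> > 0" "\<alpha> + \<beta> + \<gamma> < 1"
  shows "o' + (\<alpha> *\<^sub>R (x - o') + \<beta> *\<^sub>R (y - o') + \<gamma> *\<^sub>R (z - o')) \<in> interior (convex hull {o', x, y, z})"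
proof -
  let ?u = "\<lambda>w. if w = x then \<alpha> else if w = y then \<beta> else if w = z then \<gamma> else 1 - (\<alpha> + \<beta> + \<gamma>)"
  have "card {o', x, y, z} = 4" using assms(2) by auto
  moreover have "sum ?u {o', x, y, z} = 1" using assms(2) by auto
  moreover have "sum (\<lambda>w. ?u w *\<^sub>R w) {o', x, y, z}
      = o' + (\<alpha> *\<^sub>R (x - o') + \<beta> *\<^sub>R (y - o') + \<gamma> *\<^sub>R (z - o'))"
    using assms(2) by (auto simp: algebra_simps)
  ultimately show ?thesis
    unfolding interior_convex_hull_explicit_minimal[OF assms(1)]
    using assms(3-) by (auto intro!: exI[of _ ?u])
qed

text \<open>A point extreme in the larger hull that lay in the hull of \<open>W\<close> would be
  extreme there and thus belong to \<open>W\<close>. This supplies the chart as well as the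
  functionals that touch \<open>h\<close> from below.\<close>

lemma strictly_separated_vertex:
  fixes v :: "real^3"
  assumes "v extreme_point_of (convex hull P)" "finite W" "W \<subseteq> P" "v \<notin> W"
  obtains f where "\<And>w. w \<in> W \<Longrightarrow> f \<bullet> v < f \<bullet> w"
proof -
  have sub: "convex hull W \<subseteq> convex hull P" by (rule hull_mono) fact
  have "v \<notin> convex hull W"
  proof
    assume v: "v \<in> convex hull W"
    then have "v extreme_point_of (convex hull W)"
      using assms(1) sub unfolding extreme_point_of_def by blast
    then show False using extreme_point_of_convex_hull assms(4) by blast
  qed
  then obtain f c where "f \<bullet> v < c" "\<And>w. w \<in> convex hull W \<Longrightarrow> c < f \<bullet> w"
    using separating_hyperplane_closed_point[of "convex hull W" v] assms(2)
    by (auto simp: compact_imp_closed finite_imp_compact_convex_hull)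
  then show ?thesis using that hull_inc[of _ W convex] by (meson less_trans)
qed

text \<open>The squared distance is a quadratic polynomial in \<open>t\<close>, whose linear
  coefficient can be read off.\<close>

lemma edge_preserving_imp_orthogonal:
  assumes "preserves_edge_lengths T q" "u \<noteq> v" "closed_segment u v \<in> T"
  shows "(q u - q v) \<bullet> (u - v) = 0"
proof -
  let ?d = "\<lambda>t. dist (u + t *\<^sub>R q u) (v + t *\<^sub>R q v)"
  have "(?d has_real_derivative 0) (at 0)"
    using assms by (auto simp: preserves_edge_lengths_def)
  then have "((\<lambda>t. (?d t)\<^sup>2) has_real_derivative 0) (at 0)"
    by (auto intro!: derivative_eq_intros)
  moreover have "(?d t)\<^sup>2 = (u - v) \<bullet> (u - v) + 2 * t * ((q u - q v) \<bullet> (u - v))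
      + t\<^sup>2 * ((q u - q v) \<bullet> (q u - q v))" for t
    unfolding dist_norm power2_norm_eq_inner
    by (simp add: inner_add_left inner_add_right inner_diff_left inner_diff_right inner_commute
        power2_eq_square algebra_simps)
  moreover have "((\<lambda>t. (u - v) \<bullet> (u - v) + 2 * t * ((q u - q v) \<bullet> (u - v))
      + t\<^sup>2 * ((q u - q v) \<bullet> (q u - q v))) has_real_derivative 2 * ((q u - q v) \<bullet> (u - v))) (at 0)"
    by (auto intro!: derivative_eq_intros)
  ultimately show ?thesis using DERIV_unique by fastforce
qed

section \<open>The link of the apex and its adjacencies\<close>

locale star_triangulation =
  fixes P :: "(real^3) set" and T D :: "(real^3) set set" and v0 :: "real^3"
  assumes closed_P: "closed P"
    and complex_T: "simplicial_complex T"
    and Union_T: "\<Union>T = frontier P"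
    and triangulation_D: "triangulation D"
    and Union_D: "\<Union>D = P"
    and simplex_D: "\<And>K. K \<in> D \<Longrightarrow> 3 simplex K"
    and apex: "\<And>K. K \<in> D \<Longrightarrow> v0 extreme_point_of K"
    and compatible: "\<And>K s. K \<in> D \<Longrightarrow> s \<in> T \<Longrightarrow> (K \<inter> s) face_of K \<and> (K \<inter> s) face_of s"
begin

text \<open>Every tetrahedron occurs as six ordered triples, which makes oriented edges and signs of
  triple products available. Affine independence ensures that \<open>i\<close>, \<open>j\<close>,
  \<open>k\<close> are its actual vertices.\<close>

definition link :: "((real^3) \<times> (real^3) \<times> (real^3)) set" where
  "link = {(i, j, k). convex hull {v0, i, j, k} \<in> D \<and> \<not> affine_dependent {v0, i, j, k}
     \<and> distinct [v0, i, j, k]}"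

lemma finite_D: "finite D"
  using triangulation_D by (simp add: triangulation_def)

lemma face_D: "K \<in> D \<Longrightarrow> K' \<in> D \<Longrightarrow> (K \<inter> K') face_of K"
  using triangulation_D by (simp add: triangulation_def)

lemma linkD:
  assumes "(i, j, k) \<in> link"
  shows "convex hull {v0, i, j, k} \<in> D" "\<not> affine_dependent {v0, i, j, k}" "distinct [v0, i, j, k]"
  using assms by (auto simp: link_def)

lemma link_swap: "(i, j, k) \<in> link \<Longrightarrow> (j, i, k) \<in> link"
  and link_cyclic: "(i, j, k) \<in> link \<Longrightarrow> (j, k, i) \<in> link"
  by (auto simp: link_def insert_commute)

lemma simplex_vertices:
  assumes "K \<in> D"
  obtains C where "\<not> affine_dependent C" "card C = 4" "K = convex hull C" "finite C"
    "\<And>v. v extreme_point_of K \<longleftrightarrow> v \<in> C" "v0 \<in> C"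
proof -
  obtain C where "finite C" "\<not> affine_dependent C" "int (card C) = 3 + 1" "K = convex hull C"
    using simplex_D[OF assms] unfolding simplex by blast
  then show ?thesis
    using that[of C] apex[OF assms] by (auto simp: extreme_point_of_convex_hull_affine_independent)
qed

lemma link_from_vertices:
  assumes "K \<in> D" "i extreme_point_of K" "j extreme_point_of K" "distinct [v0, i, j]"
  obtains k where "(i, j, k) \<in> link" "K = convex hull {v0, i, j, k}"
proof -
  obtain C where C: "\<not> affine_dependent C" "card C = 4" "K = convex hull C" "finite C"
    "\<And>v. v extreme_point_of K \<longleftrightarrow> v \<in> C" "v0 \<in> C"
    using simplex_vertices[OF assms(1)] by metis
  have "card (C - {v0, i, j}) = 1"
    using C assms by (subst card_Diff_subset) auto
  then obtain k where k: "C - {v0, i, j} = {k}" by (auto simp: card_Suc_eq)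
  then have "C = {v0, i, j, k}" "k \<notin> {v0, i, j}" using C assms by auto
  then show ?thesis using that[of k] C assms by (auto simp: link_def)
qed

lemma D_eq_link:
  assumes "K \<in> D"
  obtains i j k where "(i, j, k) \<in> link" "K = convex hull {v0, i, j, k}"
proof -
  obtain C where C: "\<not> affine_dependent C" "card C = 4" "K = convex hull C" "finite C"
    "\<And>v. v extreme_point_of K \<longleftrightarrow> v \<in> C" "v0 \<in> C"
    using simplex_vertices[OF assms(1)] by metis
  have "card (C - {v0}) = 3" using C by simp
  then obtain i j where "i \<in> C - {v0}" "j \<in> C - {v0}" "i \<noteq> j"
    by (auto simp: card_Suc_eq numeral_3_eq_3)
  then have "i extreme_point_of K" "j extreme_point_of K" "distinct [v0, i, j]" using C(5) by auto
  from link_from_vertices[OF assms this]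
  obtain k where "(i, j, k) \<in> link" "K = convex hull {v0, i, j, k}" .
  then show ?thesis by (rule that)
qed

text \<open>The intersection is a face of both tetrahedra, and the extreme points of a face are
  those of the whole that lie in it.\<close>

lemma extreme_point_shared:
  assumes "K \<in> D" "K' \<in> D" "v extreme_point_of K" "v \<in> K'"
  shows "v extreme_point_of K'"
proof -
  have "v \<in> K \<inter> K'" using assms by (auto simp: extreme_point_of_def)
  then have "v extreme_point_of (K \<inter> K')"
    using extreme_point_of_face[OF face_D[OF assms(1,2)]] assms(3) by simp
  then show ?thesis
    using extreme_point_of_face[OF face_D[OF assms(2,1)]] by (simp add: Int_commute)
qed

lemma convex_closed_D:
  assumes "K \<in> D" shows "convex K" "closed K" "interior K \<noteq> {}" "interior K \<subseteq> interior P"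
proof -
  obtain i j k where K: "(i, j, k) \<in> link" "K = convex hull {v0, i, j, k}"
    using D_eq_link[OF assms] .
  show "convex K" "closed K"
    by (auto simp: K(2) compact_imp_closed finite_imp_compact_convex_hull)
  show "interior K \<noteq> {}"
    using interior_tetrahedron[OF linkD(2,3)[OF K(1)], of "1/4" "1/4" "1/4"] K(2) by auto
  show "interior K \<subseteq> interior P" using assms Union_D by (intro interior_mono) auto
qed

text \<open>A relative interior point \<open>x\<close> of the facet decides. If it lies on the
  frontier, a simplex of \<open>T\<close> through it meets \<open>K\<close> in a face containing the
  facet. If it is interior to \<open>P\<close> and in no other tetrahedron, \<open>K\<close> is a
  neighbourhood of \<open>x\<close>, impossible for a point of a proper face.\<close>

lemma facet_shared:
  assumes K: "K \<in> D" "K = convex hull C" and C: "\<not> affine_dependent C" "w \<in> C" "C \<noteq> {w}"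
    and S: "S = C - {w}"
  shows "convex hull S \<in> T \<or> (\<exists>K'\<in>D. K' \<noteq> K \<and> convex hull S \<subseteq> K')"
proof -
  let ?\<sigma> = "convex hull S"
  have face: "?\<sigma> face_of K"
    unfolding K(2) face_of_convex_hull_affine_independent[OF C(1)] using S by auto
  have sub: "?\<sigma> \<subseteq> K" using face by (rule face_of_imp_subset)
  have "w \<in> K" using C(2) K(2) by (auto intro: hull_inc)
  moreover have "w \<notin> ?\<sigma>"
    using C S extreme_point_of_convex_hull_affine_independent[OF C(1), of w]
      affine_hull_convex_hull hull_inc[of w ?\<sigma>] unfolding affine_dependent_def
    by (metis convex_hull_subset_affine_hull subsetD)
  ultimately have proper: "?\<sigma> \<noteq> K" by auto
  have "S \<noteq> {}" using C S by auto
  then obtain x where x: "x \<in> rel_interior ?\<sigma>"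
    using rel_interior_eq_empty[of ?\<sigma>] by auto
  then have xK: "x \<in> K" using rel_interior_subset sub by blast
  have meets: "?\<sigma> \<subseteq> K \<inter> L" if "(K \<inter> L) face_of K" "x \<in> L" for L
    using that x xK by (intro subset_of_face_of[OF that(1) sub]) auto
  show ?thesis
  proof (cases "x \<in> frontier P")
    case True
    then obtain s where s: "s \<in> T" "x \<in> s" using Union_T by blast
    have f: "(K \<inter> s) face_of K" "(K \<inter> s) face_of s" using compatible[OF K(1) s(1)] by auto
    have "K \<inter> s \<in> T" using complex_T s(1) f(2) unfolding simplicial_complex_def by blast
    moreover have "?\<sigma> face_of (K \<inter> s)"
      using face_of_subset[OF face meets[OF f(1) s(2)]] by simp
    ultimately show ?thesis using complex_T unfolding simplicial_complex_def by blast
  next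
    case False
    then have xP: "x \<in> interior P"
      using xK K(1) Union_D closed_P by (auto simp: frontier_def)
    show ?thesis
    proof (rule ccontr)
      assume neg: "\<not> ?thesis"
      let ?U = "\<Union>(D - {K})"
      have "x \<notin> ?U" using neg meets face_D[OF K(1)] by blast
      moreover have "closed ?U"
        using finite_D convex_closed_D(2) by (intro closed_Union) auto
      moreover have "interior P - ?U \<subseteq> K"
        using Union_D interior_subset[of P] by blast
      ultimately have "x \<in> interior K"
        using xP by (intro interiorI[of "interior P - ?U"]) auto
      then show False
        using face_of_disjoint_interior[OF face proper] x rel_interior_subset by blast
    qed
  qed
qed

text \<open>A second tetrahedron over this triangle would also have the common apex
  \<open>v0\<close>, hence the same four vertices.\<close>

lemma outer_triangle_in_T:
  assumes "(i, j, k) \<in> link"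
  shows "convex hull {i, j, k} \<in> T"
proof -
  let ?C = "{v0, i, j, k}"
  note l = linkD[OF assms]
  have "{i, j, k} = ?C - {v0}" using l(3) by auto
  from facet_shared[OF l(1) refl l(2) _ _ this] l(3)
  have "convex hull {i, j, k} \<in> T \<or> (\<exists>K'\<in>D. K' \<noteq> convex hull ?C \<and> convex hull {i, j, k} \<subseteq> K')"
    by auto
  then show ?thesis
  proof
    assume "\<exists>K'\<in>D. K' \<noteq> convex hull ?C \<and> convex hull {i, j, k} \<subseteq> K'"
    then obtain K' where K': "K' \<in> D" "K' \<noteq> convex hull ?C" "convex hull {i, j, k} \<subseteq> K'" by blast
    obtain C where C: "\<not> affine_dependent C" "card C = 4" "K' = convex hull C" "finite C"
      "\<And>v. v extreme_point_of K' \<longleftrightarrow> v \<in> C" "v0 \<in> C"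
      using simplex_vertices[OF K'(1)] by metis
    have "v \<in> C" if "v \<in> {i, j, k}" for v
      using extreme_point_shared[OF l(1) K'(1), of v] that K'(3) hull_inc[of v "{i, j, k}" convex]
        extreme_point_of_convex_hull_affine_independent[OF l(2), of v] C(5) by auto
    then have "?C \<subseteq> C" using C(6) by auto
    moreover have "card ?C = 4" using l(3) by auto
    ultimately have "?C = C" using C(2,4) by (intro card_subset_eq) auto
    then show ?thesis using K' C by simp
  qed simp
qed

lemma subface_in_T:
  assumes "convex hull C \<in> T" "\<not> affine_dependent C" "B \<subseteq> C"
  shows "convex hull B \<in> T"
proof -
  have "convex hull B face_of convex hull C"
    using assms(3) by (auto simp: face_of_convex_hull_affine_independent[OF assms(2)])
  then show ?thesis using complex_T assms(1) unfolding simplicial_complex_def by blast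
qed

lemma link_edge_in_T:
  assumes "(i, j, k) \<in> link"
  shows "closed_segment i j \<in> T"
proof -
  have "\<not> affine_dependent {i, j, k}"
    using linkD(2)[OF assms] affine_dependent_subset[of "{i, j, k}"] by blast
  from subface_in_T[OF outer_triangle_in_T[OF assms] this, of "{i, j}"]
  show ?thesis by (simp add: segment_convex_hull)
qed

text \<open>Two tetrahedra on the same side of a common triangle overlap just above it. As they meet
  along faces, they would coincide.\<close>

lemma link_opposite_sides:
  assumes l: "(i, j, k) \<in> link" "(i, j, k') \<in> link" and "k \<noteq> k'"
  shows "(cross3 (i - v0) (j - v0) \<bullet> (k - v0)) * (cross3 (i - v0) (j - v0) \<bullet> (k' - v0)) < 0"
proof (rule ccontr)
  assume neg: "\<not> ?thesis"
  let ?K = "convex hull {v0, i, j, k}" and ?K' = "convex hull {v0, i, j, k'}"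
  note l1 = linkD[OF l(1)] and l2 = linkD[OF l(2)]
  have nz: "cross3 (i - v0) (j - v0) \<bullet> (k - v0) \<noteq> 0" "cross3 (i - v0) (j - v0) \<bullet> (k' - v0) \<noteq> 0"
    using triple_product_nonzero[OF l1(2,3)] triple_product_nonzero[OF l2(2,3)] by auto
  define z where "z = (cross3 (i - v0) (j - v0) \<bullet> (k' - v0)) / (cross3 (i - v0) (j - v0) \<bullet> (k - v0))"
  have z: "z > 0" using neg nz by (auto simp: z_def zero_less_divide_iff not_less zero_le_mult_iff)
  obtain x y where k': "k' - v0 = x *\<^sub>R (i - v0) + y *\<^sub>R (j - v0) + z *\<^sub>R (k - v0)"
    using cramer3[OF nz(1), of "k' - v0"] unfolding z_def by blast
  \<comment> \<open>\<open>\<epsilon>\<close> is small enough to keep the coordinates of the test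
    point positive in both tetrahedra; the factor \<open>\<mu>\<close> then contracts towards
    \<open>v0\<close> until both coordinate sums are below 1.\<close>
  define \<epsilon> where "\<epsilon> = 1 / (1 + \<bar>x\<bar> + \<bar>y\<bar>)"
  have \<epsilon>: "\<epsilon> > 0" "1 + \<epsilon> * x > 0" "1 + \<epsilon> * y > 0"
    by (auto simp: \<epsilon>_def field_simps)
  define \<mu> where "\<mu> = 1 / (3 + \<epsilon> + \<epsilon> * \<bar>x\<bar> + \<epsilon> * \<bar>y\<bar> + \<epsilon> * z)"
  define d where "d = 3 + \<epsilon> + \<epsilon> * \<bar>x\<bar> + \<epsilon> * \<bar>y\<bar> + \<epsilon> * z"
  have nonneg: "\<epsilon> * \<bar>x\<bar> \<ge> 0" "\<epsilon> * \<bar>y\<bar> \<ge> 0" "\<epsilon> * z > 0"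
    "\<epsilon> * x \<le> \<epsilon> * \<bar>x\<bar>" "\<epsilon> * y \<le> \<epsilon> * \<bar>y\<bar>"
    using \<epsilon> z by auto
  then have d: "d > 0" "2 + \<epsilon> < d" "(1 + \<epsilon> * x) + (1 + \<epsilon> * y) + \<epsilon> * z < d"
    unfolding d_def using \<epsilon>(1) by linarith+
  have "\<mu> = 1 / d" by (simp add: \<mu>_def d_def)
  with d have \<mu>: "\<mu> > 0" "\<mu> + \<mu> + \<mu> * \<epsilon> < 1"
    "\<mu> * (1 + \<epsilon> * x) + \<mu> * (1 + \<epsilon> * y) + \<mu> * (\<epsilon> * z) < 1"
    by (simp_all flip: distrib_left add_divide_distrib)
  let ?w = "v0 + (\<mu> *\<^sub>R (i - v0) + \<mu> *\<^sub>R (j - v0) + (\<mu> * \<epsilon>) *\<^sub>R (k' - v0))"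
  have w': "?w \<in> interior ?K'"
    using \<mu> \<epsilon> by (intro interior_tetrahedron l2) auto
  have "?w = v0 + ((\<mu> * (1 + \<epsilon> * x)) *\<^sub>R (i - v0) + (\<mu> * (1 + \<epsilon> * y)) *\<^sub>R (j - v0) + (\<mu> * (\<epsilon> * z)) *\<^sub>R (k - v0))"
    unfolding k' by (simp add: algebra_simps)
  also have "\<dots> \<in> interior ?K"
    using \<mu> \<epsilon> z by (intro interior_tetrahedron l1) auto
  finally have w: "?w \<in> interior ?K" .
  have "?K \<inter> ?K' = ?K" "?K' \<inter> ?K = ?K'"
    using face_of_disjoint_interior[OF face_D[OF l1(1) l2(1)]]
      face_of_disjoint_interior[OF face_D[OF l2(1) l1(1)]] w w' interior_subset by blast+
  then have "?K = ?K'" by blast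
  then have "k extreme_point_of ?K'"
    using extreme_point_of_convex_hull_affine_independent[OF l1(2), of k] by auto
  then show False
    using extreme_point_of_convex_hull_affine_independent[OF l2(2), of k] l1(3) \<open>k \<noteq> k'\<close> by auto
qed

text \<open>A triangle through \<open>v0\<close> that is not in \<open>T\<close> borders a second
  tetrahedron. A third is excluded because three nonzero numbers cannot have pairwise opposite
  signs.\<close>

lemma link_adjacent:
  assumes l: "(i, j, k) \<in> link"
  shows "closed_segment v0 i \<in> T \<and> closed_segment v0 j \<in> T \<or>
    (\<exists>k'. {m. (i, j, m) \<in> link} = {k, k'} \<and>
      (cross3 (i - v0) (j - v0) \<bullet> (k - v0)) * (cross3 (i - v0) (j - v0) \<bullet> (k' - v0)) < 0)"
proof -
  let ?C = "{v0, i, j, k}"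
  note l1 = linkD[OF l]
  have ind: "\<not> affine_dependent {v0, i, j}"
    using l1(2) affine_dependent_subset[of "{v0, i, j}" ?C] by blast
  have "{v0, i, j} = ?C - {k}" using l1(3) by auto
  from facet_shared[OF l1(1) refl l1(2) _ _ this] l1(3)
  have "convex hull {v0, i, j} \<in> T \<or> (\<exists>K'\<in>D. K' \<noteq> convex hull ?C \<and> convex hull {v0, i, j} \<subseteq> K')"
    by auto
  then show ?thesis
  proof
    assume t: "convex hull {v0, i, j} \<in> T"
    then show ?thesis
      using subface_in_T[OF t ind, of "{v0, i}"] subface_in_T[OF t ind, of "{v0, j}"]
      by (simp add: segment_convex_hull)
  next
    assume "\<exists>K'\<in>D. K' \<noteq> convex hull ?C \<and> convex hull {v0, i, j} \<subseteq> K'"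
    then obtain K' where K': "K' \<in> D" "K' \<noteq> convex hull ?C" "convex hull {v0, i, j} \<subseteq> K'" by blast
    have "v extreme_point_of K'" if "v \<in> {i, j}" for v
      using extreme_point_shared[OF l1(1) K'(1), of v] that K'(3) hull_inc[of v "{v0, i, j}" convex]
        extreme_point_of_convex_hull_affine_independent[OF l1(2), of v] by auto
    then obtain k' where k': "(i, j, k') \<in> link" "K' = convex hull {v0, i, j, k'}"
      using link_from_vertices[OF K'(1), of i j] l1(3) by auto
    have ne: "k \<noteq> k'" using K'(2) k'(2) by auto
    have "m = k \<or> m = k'" if m: "(i, j, m) \<in> link" for m
    proof (rule ccontr)
      assume "\<not> ?thesis"
      then have "k \<noteq> m" "k' \<noteq> m" by auto
      from link_opposite_sides[OF l k'(1) ne] link_opposite_sides[OF l m this(1)]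
        link_opposite_sides[OF k'(1) m this(2)]
      show False by (auto simp: mult_less_0_iff)
    qed
    then have "{m. (i, j, m) \<in> link} = {k, k'}" using l k'(1) by auto
    then show ?thesis using link_opposite_sides[OF l k'(1) ne] by blast
  qed
qed

end

subsection \<open>Gluing the infinitesimal rotations\<close>

lemma rotation_vector_exists:
  fixes v1 v2 v3 w1 w2 w3 :: "real^3"
  assumes det: "cross3 v1 v2 \<bullet> v3 \<noteq> 0"
    and "w1 \<bullet> v1 = 0" "w2 \<bullet> v2 = 0" "w3 \<bullet> v3 = 0"
    and "w1 \<bullet> v2 + w2 \<bullet> v1 = 0" "w2 \<bullet> v3 + w3 \<bullet> v2 = 0" "w3 \<bullet> v1 + w1 \<bullet> v3 = 0"
  obtains \<omega> where "w1 = cross3 \<omega> v1" "w2 = cross3 \<omega> v2" "w3 = cross3 \<omega> v3"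
proof -
  define D where "D = cross3 v1 v2 \<bullet> v3"
  \<comment> \<open>Forced by \<open>w1 \<bullet> v2 = \<omega> \<bullet> cross3 v1 v2\<close> and
    its cyclic analogues: pairing with \<open>cross3 v1 v2\<close> isolates the coefficient of
    \<open>v3\<close>, multiplied by \<open>D\<close>.\<close>
  define \<omega> where "\<omega> = (1 / D) *\<^sub>R ((w2 \<bullet> v3) *\<^sub>R v1 + (w3 \<bullet> v1) *\<^sub>R v2 + (w1 \<bullet> v2) *\<^sub>R v3)"
  have triple: "cross3 v1 v2 \<bullet> v3 = D" "cross3 v2 v3 \<bullet> v1 = D" "cross3 v3 v1 \<bullet> v2 = D"
    "cross3 v2 v1 \<bullet> v3 = - D" "cross3 v3 v2 \<bullet> v1 = - D" "cross3 v1 v3 \<bullet> v2 = - D"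
    by (simp_all add: D_def cross3_simps)
  have eqI: "x = y" if e: "x \<bullet> v1 = y \<bullet> v1" "x \<bullet> v2 = y \<bullet> v2" "x \<bullet> v3 = y \<bullet> v3" for x y
  proof -
    obtain \<alpha> \<beta> \<gamma> where "x - y = \<alpha> *\<^sub>R v1 + \<beta> *\<^sub>R v2 + \<gamma> *\<^sub>R v3"
      using cramer3[OF det] by blast
    from arg_cong[OF this, of "\<lambda>u. (x - y) \<bullet> u"] have "(x - y) \<bullet> (x - y) = 0"
      using e by (simp add: inner_add_right inner_diff_left)
    then show ?thesis by simp
  qed
  have "D \<noteq> 0" using det by (simp add: D_def)
  have exp: "cross3 \<omega> v = (1 / D) *\<^sub>R ((w2 \<bullet> v3) *\<^sub>R cross3 v1 v + (w3 \<bullet> v1) *\<^sub>R cross3 v2 v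
      + (w1 \<bullet> v2) *\<^sub>R cross3 v3 v)" for v
    by (simp add: \<omega>_def cross_mult_left cross_add_left)
  have "w1 = cross3 \<omega> v1" "w2 = cross3 \<omega> v2" "w3 = cross3 \<omega> v3"
    by (rule eqI; use assms \<open>D \<noteq> 0\<close> in \<open>simp add: exp inner_add_left triple dot_cross_self\<close>)+
  then show ?thesis by (rule that)
qed

lemma eq_0_if_inner_const_on_open:
  fixes n :: "'a::euclidean_space"
  assumes "open U" "x \<in> U" "\<And>y. y \<in> U \<Longrightarrow> n \<bullet> y = c"
  shows "n = 0"
proof (rule ccontr)
  assume "n \<noteq> 0"
  have "((\<lambda>t::real. x + t *\<^sub>R n) \<longlongrightarrow> x + 0 *\<^sub>R n) (at_right 0)" by (intro tendsto_intros)
  then have "\<forall>\<^sub>F t::real in at_right 0. x + t *\<^sub>R n \<in> U"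
    using assms(1,2) by (auto dest: topological_tendstoD)
  then have "\<forall>\<^sub>F t::real in at_right 0. t > 0 \<and> x + t *\<^sub>R n \<in> U"
    by (intro eventually_conj eventually_at_right_less)
  from eventually_happens'[OF trivial_limit_at_right_real this]
  obtain t :: real where "t > 0" "x + t *\<^sub>R n \<in> U" by blast
  then show False using assms(3)[of x] assms(3)[of "x + t *\<^sub>R n"] assms(2) \<open>n \<noteq> 0\<close>
    by (simp add: inner_add_right)
qed

text \<open>For fixed \<open>z\<close> the expression is affine in \<open>y\<close>, so
  \<open>z - v0\<close> is parallel to \<open>\<delta>\<close>; this for all \<open>z\<close> in an
  open set leaves only \<open>\<delta> = 0\<close>.\<close>

lemma cross3_triple_zero_on_open:
  fixes \<delta> v0 :: "real^3"
  assumes U: "open U" "U \<noteq> {}" and V: "open V" "V \<noteq> {}"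
    and 0: "\<And>y z. y \<in> U \<Longrightarrow> z \<in> V \<Longrightarrow> cross3 \<delta> (y - v0) \<bullet> (z - y) = 0"
  shows "\<delta> = 0"
proof -
  have *: "cross3 (z - v0) \<delta> = 0" if z: "z \<in> V" for z
  proof -
    obtain x where "x \<in> U" using U by blast
    moreover have "cross3 (z - v0) \<delta> \<bullet> y = cross3 (z - v0) \<delta> \<bullet> v0" if "y \<in> U" for y
      using 0[OF that z] by (simp add: cross3_simps)
    ultimately show ?thesis by (rule eq_0_if_inner_const_on_open[OF U(1)])
  qed
  have "cross3 \<delta> e = 0" for e
  proof -
    obtain x where "x \<in> V" using V by blast
    moreover have "cross3 \<delta> e \<bullet> z = cross3 \<delta> e \<bullet> v0" if "z \<in> V" for z
    proof -
      have "cross3 (z - v0) \<delta> \<bullet> e = 0" by (simp add: *[OF that])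
      then show ?thesis by (simp add: cross3_simps)
    qed
    ultimately show ?thesis by (rule eq_0_if_inner_const_on_open[OF V(1)])
  qed
  then show ?thesis using cross_basis_nonzero[of \<delta>] by blast
qed

context star_triangulation
begin

text \<open>The two tetrahedra may share only an edge through \<open>x\<close>, where agreement of
  the fields does not determine the rotation vector. Segments near \<open>x\<close> from one to the
  other, with end points ranging over open sets, carry enough information.\<close>

lemma rotation_vectors_agree_at_interior_point:
  fixes q :: "real^3 \<Rightarrow> real^3" and \<omega> :: "(real^3) set \<Rightarrow> real^3"
  assumes \<omega>: "\<And>K v. K \<in> D \<Longrightarrow> v extreme_point_of K \<Longrightarrow> q v = q v0 + cross3 (\<omega> K) (v - v0)"
    and K: "K \<in> D" "x \<in> K" and K': "K' \<in> D" "x \<in> K'" and x: "x \<in> interior P"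
  shows "\<omega> K = \<omega> K'"
proof -
  obtain e where e: "e > 0" "ball x e \<subseteq> P" using x by (auto simp: mem_interior)
  have agree: "cross3 (\<omega> K) (y - v0) = cross3 (\<omega> L) (y - v0)" if L: "K \<in> D" "L \<in> D" "y \<in> K \<inter> L" for K L y
  proof -
    obtain C where C: "\<not> affine_dependent C" "card C = 4" "K = convex hull C" "finite C"
      "\<And>v. v extreme_point_of K \<longleftrightarrow> v \<in> C" "v0 \<in> C"
      using simplex_vertices[OF L(1)] by metis
    obtain C' where C': "C' \<subseteq> C" "K \<inter> L = convex hull C'"
      using face_D[OF L(1,2)] face_of_convex_hull_affine_independent[OF C(1)] C(3) by auto
    let ?E = "{y. cross3 (\<omega> K) (y - v0) = cross3 (\<omega> L) (y - v0)}"
    have "C' \<subseteq> ?E"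
    proof safe
      fix v assume v: "v \<in> C'"
      then have "v extreme_point_of K" "v \<in> L" using C C' hull_inc[of v C' convex] by auto
      then show "cross3 (\<omega> K) (v - v0) = cross3 (\<omega> L) (v - v0)"
        using \<omega>[OF L(1)] \<omega>[OF L(2)] extreme_point_shared[OF L(1,2)] by (metis add_left_cancel)
    qed
    moreover have "convex ?E"
    proof (rule convexI)
      fix y z and u t :: real assume "y \<in> ?E" "z \<in> ?E" and ut: "u + t = 1"
      have "u *\<^sub>R y + t *\<^sub>R z - v0 = u *\<^sub>R (y - v0) + t *\<^sub>R (z - v0)"
        using ut by (simp add: algebra_simps flip: scaleR_add_left)
      then show "u *\<^sub>R y + t *\<^sub>R z \<in> ?E"
        using \<open>y \<in> ?E\<close> \<open>z \<in> ?E\<close> by (simp add: cross_add_right cross_mult_right)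
    qed
    ultimately have "convex hull C' \<subseteq> ?E" by (rule hull_minimal)
    then show ?thesis using L(3) C'(2) by blast
  qed
  \<comment> \<open>The component along a segment of a field that is skew on every piece is constant on each piece,
    hence on the segment by connectedness.\<close>
  have seg: "cross3 (\<omega> K' - \<omega> K) (y - v0) \<bullet> (z - y) = 0"
    if y: "y \<in> K" "y \<in> ball x e" and z: "z \<in> K'" "z \<in> ball x e" for y z
  proof -
    define d where "d = z - y"
    define c where "c L = cross3 (\<omega> L) (y - v0) \<bullet> d" for L
    define S where "S \<A> = (\<Union>L\<in>\<A>. {s \<in> {0..1::real}. y + s *\<^sub>R d \<in> L})" for \<A>
    have closed_S: "closed (S \<A>)" if "\<A> \<subseteq> D" for \<A>
    proof -
      have "closed {s \<in> {0..1}. y + s *\<^sub>R d \<in> L}" if "L \<in> D" for L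
      proof -
        have "{s \<in> {0..1}. y + s *\<^sub>R d \<in> L} = {0..1} \<inter> (\<lambda>s. y + s *\<^sub>R d) -` L" by auto
        then show ?thesis
          using convex_closed_D(2)[OF that]
          by (auto intro!: closed_Int closed_vimage continuous_intros)
      qed
      then show ?thesis unfolding S_def using that finite_subset[OF that finite_D]
        by (intro closed_UN) auto
    qed
    let ?A = "{L \<in> D. c L = c K}" and ?B = "{L \<in> D. c L \<noteq> c K}"
    have "{0..1} \<subseteq> S ?A \<union> S ?B"
    proof
      fix s :: real assume s: "s \<in> {0..1}"
      have "y + s *\<^sub>R d = (1 - s) *\<^sub>R y + s *\<^sub>R z" by (simp add: d_def algebra_simps)
      also have "\<dots> \<in> ball x e" using y z s by (intro convexD_alt[OF convex_ball]) auto
      finally obtain L where "L \<in> D" "y + s *\<^sub>R d \<in> L" using e(2) Union_D by blast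
      then show "s \<in> S ?A \<union> S ?B" using s by (cases "c L = c K") (auto simp: S_def)
    qed
    moreover have "S ?A \<inter> S ?B = {}"
    proof -
      have False if "L \<in> ?A" "M \<in> ?B" "y + s *\<^sub>R d \<in> L" "y + s *\<^sub>R d \<in> M" for L M s
      proof -
        have "cross3 (\<omega> L) (y + s *\<^sub>R d - v0) = cross3 (\<omega> M) (y + s *\<^sub>R d - v0)"
          using agree that by auto
        moreover have "cross3 w (y + s *\<^sub>R d - v0) \<bullet> d = cross3 w (y - v0) \<bullet> d" for w
          by (simp add: cross3_simps)
        ultimately have "c L = c M" unfolding c_def by metis
        then show False using that by auto
      qed
      then show ?thesis unfolding S_def by blast
    qed
    moreover have "0 \<in> S ?A" using y K by (auto simp: S_def)
    ultimately have disjoint: "{0..1} \<inter> S ?B = {}"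
      using connected_closedD[of "{0..1::real}" "S ?A" "S ?B"] closed_S by auto
    have "c K' = c K"
    proof (rule ccontr)
      assume "c K' \<noteq> c K"
      then have "1 \<in> {0..1} \<inter> S ?B" using z K' by (auto simp: S_def d_def)
      then show False unfolding disjoint by simp
    qed
    then show ?thesis by (simp add: c_def d_def cross_minus_left inner_diff_left Cross3.left_diff_distrib)
  qed
  have meets: "interior L \<inter> ball x e \<noteq> {}" if "L \<in> D" "x \<in> L" for L
  proof -
    have "closure (interior L) = closure L"
      using convex_closed_D[OF that(1)] by (intro convex_closure_interior)
    then have "x \<in> closure (interior L)" using that closure_subset by blast
    then obtain y where "y \<in> interior L" "dist y x < e"
      using e(1) unfolding closure_approachable by blast
    then show ?thesis by (auto simp: dist_commute)
  qed
  have "\<omega> K' - \<omega> K = 0"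
  proof (rule cross3_triple_zero_on_open[OF _ meets[OF K] _ meets[OF K']])
    show "cross3 (\<omega> K' - \<omega> K) (y - v0) \<bullet> (z - y) = 0"
      if "y \<in> interior K \<inter> ball x e" "z \<in> interior K' \<inter> ball x e" for y z
      using that interior_subset[of K] interior_subset[of K'] by (intro seg) blast+
  qed (simp_all add: open_Int)
  then show ?thesis by simp
qed

lemma rotation_vectors_agree:
  fixes q :: "real^3 \<Rightarrow> real^3" and \<omega> :: "(real^3) set \<Rightarrow> real^3"
  assumes \<omega>: "\<And>K v. K \<in> D \<Longrightarrow> v extreme_point_of K \<Longrightarrow> q v = q v0 + cross3 (\<omega> K) (v - v0)"
    and con: "connected (interior P)" and K: "K \<in> D" and K': "K' \<in> D"
  shows "\<omega> K = \<omega> K'"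
proof (rule ccontr)
  assume ne: "\<omega> K \<noteq> \<omega> K'"
  let ?A = "\<Union>{L \<in> D. \<omega> L = \<omega> K}" and ?B = "\<Union>{L \<in> D. \<omega> L \<noteq> \<omega> K}"
  have "closed ?A" "closed ?B"
    using finite_D convex_closed_D(2) by (auto intro!: closed_Union)
  moreover have "?A \<inter> ?B \<inter> interior P = {}"
  proof (rule ccontr)
    assume "?A \<inter> ?B \<inter> interior P \<noteq> {}"
    then obtain x L M where x: "x \<in> interior P" and L: "L \<in> D" "x \<in> L" "\<omega> L = \<omega> K"
      and M: "M \<in> D" "x \<in> M" "\<omega> M \<noteq> \<omega> K"
      by blast
    have "\<omega> L = \<omega> M"
      by (rule rotation_vectors_agree_at_interior_point[where q = q, OF _ L(1,2) M(1,2) x]) (rule \<omega>)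
    then show False using L M by simp
  qed
  moreover have "interior P \<subseteq> ?A \<union> ?B" using Union_D interior_subset[of P] by blast
  ultimately have disj: "?A \<inter> interior P = {} \<or> ?B \<inter> interior P = {}"
    by (intro connected_closedD[OF con])
  have "L \<inter> interior P \<noteq> {}" if "L \<in> D" for L
    using convex_closed_D(3,4)[OF that] interior_subset[of L] by blast
  then obtain x y where "x \<in> K \<inter> interior P" "y \<in> K' \<inter> interior P" using K K' by blast
  then have "x \<in> ?A \<inter> interior P" "y \<in> ?B \<inter> interior P" using K K' ne by auto
  with disj show False by (elim disjE) (simp_all only: empty_iff)
qed

end

lemma killing_field_rotation: "killing_field (\<lambda>x. w + cross3 \<omega> (x - v))"
  unfolding killing_field_def
proof (intro allI exI conjI)
  fix x
  have "linear (cross3 \<omega>)"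
    by (intro linearI) (simp_all add: cross_add_right cross_mult_right)
  then have bl: "bounded_linear (cross3 \<omega>)" by (simp add: linear_linear)
  show "((\<lambda>x. w + cross3 \<omega> (x - v)) has_derivative cross3 \<omega>) (at x)"
    by (rule has_derivative_eq_rhs, rule has_derivative_add[OF has_derivative_const],
        rule bounded_linear.has_derivative[OF bl], rule has_derivative_diff[OF has_derivative_ident has_derivative_const])
      simp
  show "cross3 \<omega> a \<bullet> b + a \<bullet> cross3 \<omega> b = 0" for a b by (simp add: cross3_simps)
qed

section \<open>From extremality of the vertices to one infinitesimal rotation\<close>

context star_triangulation
begin

text \<open>Extremality of \<open>v0\<close> gives the chart \<open>a\<close>; that of each link
  vertex \<open>i\<close> gives \<open>b i\<close>, equal to 1 at \<open>i - v0\<close> and smaller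
  at the others. Scaling by the positive \<open>h\<close> makes the \<open>b i\<close> touch the
  values \<open>h\<close> from below at single vertices: this is the strict convexity required of
  \<open>h\<close>.\<close>

lemma no_radial_variation:
  assumes vertices: "\<forall>K\<in>D. \<forall>v. v extreme_point_of K \<longrightarrow> v extreme_point_of (convex hull P)"
    and pres: "preserves_edge_lengths T q" and l: "(i, j, k) \<in> link"
  shows "(q i - q v0) \<bullet> (i - v0) = 0"
proof -
  define I where "I = {i. \<exists>j k. (i, j, k) \<in> link}"
  have I_props: "i \<noteq> v0" "\<exists>K\<in>D. i extreme_point_of K" if i: "i \<in> I" for i
  proof -
    obtain j k where "(i, j, k) \<in> link" using i by (auto simp: I_def)
    from linkD[OF this] show "i \<noteq> v0" "\<exists>K\<in>D. i extreme_point_of K"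
      using extreme_point_of_convex_hull_affine_independent[of "{v0, i, j, k}" i] by auto
  qed
  have "I \<subseteq> (\<Union>K\<in>D. {v. v extreme_point_of K})" using I_props by auto
  moreover have "finite {v. v extreme_point_of K}" if "K \<in> D" for K
    using simplex_vertices[OF that] by (metis (no_types, lifting) finite_subset mem_Collect_eq subsetI)
  ultimately have fin: "finite I" using finite_D by (meson finite_UN finite_subset)
  have I_sub: "insert v0 I \<subseteq> P"
  proof -
    have "v0 \<in> P" using linkD(1)[OF l] hull_inc[of v0 "{v0, i, j, k}" convex] Union_D by auto
    moreover have "I \<subseteq> P"
    proof
      fix i assume "i \<in> I"
      then obtain K where "K \<in> D" "i extreme_point_of K" using I_props(2) by blast
      then show "i \<in> P" using Union_D by (auto simp: extreme_point_of_def)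
    qed
    ultimately show ?thesis by simp
  qed
  have v0_ext: "v0 extreme_point_of (convex hull P)"
    using vertices linkD(1)[OF l] apex[OF linkD(1)[OF l]] by blast
  obtain a where a: "\<And>w. w \<in> I \<Longrightarrow> a \<bullet> v0 < a \<bullet> w"
  proof (rule strictly_separated_vertex[OF v0_ext fin])
    show "I \<subseteq> P" "v0 \<notin> I" using I_sub I_props(1) by auto
  qed (rule that)
  have "\<exists>b. b \<bullet> (i - v0) = 1 \<and> (\<forall>j\<in>I - {i}. b \<bullet> (j - v0) < 1)" if i: "i \<in> I" for i
  proof -
    obtain f where f: "\<And>w. w \<in> insert v0 (I - {i}) \<Longrightarrow> f \<bullet> i < f \<bullet> w"
    proof (rule strictly_separated_vertex)
      show "i extreme_point_of (convex hull P)" using I_props[OF i] vertices by blast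
      show "finite (insert v0 (I - {i}))" "insert v0 (I - {i}) \<subseteq> P" "i \<notin> insert v0 (I - {i})"
        using fin I_sub I_props(1)[OF i] by auto
    qed (rule that)
    \<comment> \<open>As \<open>v0\<close> is among the separated points, \<open>c\<close> is
      positive, and dividing by \<open>- c\<close> normalises the increment of \<open>f\<close> from
      \<open>v0\<close> to \<open>i\<close> to 1.\<close>
    define c where "c = f \<bullet> v0 - f \<bullet> i"
    have c: "c > 0" using f by (simp add: c_def)
    have "(- (1 / c) *\<^sub>R f) \<bullet> (i - v0) = 1" using c by (simp add: c_def inner_diff_right divide_simps)
    moreover have "(- (1 / c) *\<^sub>R f) \<bullet> (j - v0) < 1" if "j \<in> I - {i}" for j
    proof -
      have "f \<bullet> v0 - f \<bullet> j < c" using f[of j] that by (simp add: c_def)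
      then have "(f \<bullet> v0 - f \<bullet> j) / c < 1" using c by simp
      then show ?thesis by (simp add: inner_diff_right diff_divide_distrib)
    qed
    ultimately show ?thesis by blast
  qed
  then obtain b where b: "\<And>i. i \<in> I \<Longrightarrow> b i \<bullet> (i - v0) = 1"
    "\<And>i j. i \<in> I \<Longrightarrow> j \<in> I \<Longrightarrow> i \<noteq> j \<Longrightarrow> b i \<bullet> (j - v0) < 1" by (metis DiffI singletonD)
  define h where "h i = 1 / (a \<bullet> (i - v0))" for i
  have h: "h i > 0" if "i \<in> I" for i using a[OF that] by (simp add: h_def inner_diff_right)
  define p where "p i = h i *\<^sub>R (i - v0)" for i
  define g where "g i = h i * ((q i - q v0) \<bullet> (i - v0))" for i
  have det: "cross3 (p i) (p j) \<bullet> p k = (h i * h j * h k) * (cross3 (i - v0) (j - v0) \<bullet> (k - v0))" for i j k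
    by (simp add: p_def cross_mult_left cross_mult_right mult_ac)
  have link_I: "i \<in> I" "j \<in> I" "k \<in> I" if "(i, j, k) \<in> link" for i j k
    using that link_cyclic[OF that] link_cyclic[OF link_cyclic[OF that]] by (auto simp: I_def)
  have "g i = 0"
  proof (rule no_radial_stretch[where T = link and I = I and p = p and b = b and h = h and a = a
        and q = "\<lambda>i. h i *\<^sub>R (q i - q v0)"])
    show "finite I" by fact
    show "link \<subseteq> I \<times> I \<times> I" using link_I by auto
    show "(j, k, i) \<in> link" "(j, i, k) \<in> link" if "(i, j, k) \<in> link" for i j k
      using link_cyclic[OF that] link_swap[OF that] by simp_all
    show "cross3 (p i) (p j) \<bullet> p k \<noteq> 0" if "(i, j, k) \<in> link" for i j k
      using triple_product_nonzero[OF linkD(2,3)[OF that]] h[OF link_I(1)[OF that]]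
        h[OF link_I(2)[OF that]] h[OF link_I(3)[OF that]] by (simp add: det)
    show "g i = 0 \<and> g j = 0 \<or> (\<exists>k'. {l. (i, j, l) \<in> link} = {k, k'} \<and>
        (cross3 (p i) (p j) \<bullet> p k) * (cross3 (p i) (p j) \<bullet> p k') < 0)"
      if t: "(i, j, k) \<in> link" for i j k
      using link_adjacent[OF t]
    proof
      assume s: "closed_segment v0 i \<in> T \<and> closed_segment v0 j \<in> T"
      have "i \<noteq> v0" "j \<noteq> v0" using link_I[OF t] I_props by auto
      then have "(q i - q v0) \<bullet> (i - v0) = 0" "(q j - q v0) \<bullet> (j - v0) = 0"
        using s edge_preserving_imp_orthogonal[OF pres] by (auto simp: closed_segment_commute)
      then show ?thesis by (simp add: g_def)
    next
      assume "\<exists>k'. {m. (i, j, m) \<in> link} = {k, k'} \<and>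
        (cross3 (i - v0) (j - v0) \<bullet> (k - v0)) * (cross3 (i - v0) (j - v0) \<bullet> (k' - v0)) < 0"
      then obtain k' where k': "{m. (i, j, m) \<in> link} = {k, k'}"
        "(cross3 (i - v0) (j - v0) \<bullet> (k - v0)) * (cross3 (i - v0) (j - v0) \<bullet> (k' - v0)) < 0" by blast
      have t': "(i, j, k') \<in> link" using k'(1) by auto
      define s where "s = (h i * h j * h k) * (h i * h j * h k')"
      have "s > 0" using h link_I[OF t] link_I[OF t'] by (simp add: s_def)
      then have "s * ((cross3 (i - v0) (j - v0) \<bullet> (k - v0)) * (cross3 (i - v0) (j - v0) \<bullet> (k' - v0))) < 0"
        using k'(2) by (simp add: mult_less_0_iff)
      then have "(cross3 (p i) (p j) \<bullet> p k) * (cross3 (p i) (p j) \<bullet> p k') < 0"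
        unfolding det s_def by (simp only: mult_ac)
      then show ?thesis using k'(1) by blast
    qed
    show "a \<bullet> p i = 1" if "i \<in> I" for i
      using h[OF that] by (simp add: p_def h_def)
    show "b i \<bullet> p i = h i" if "i \<in> I" for i
      using b(1)[OF that] by (simp add: p_def)
    show "b i \<bullet> p j < h j" if "i \<in> I" "j \<in> I" "i \<noteq> j" for i j
      using b(2)[OF that] h[OF that(2)] by (simp add: p_def)
    show "(h i *\<^sub>R (q i - q v0)) \<bullet> p i = g i * h i" for i
      by (simp add: p_def g_def)
    show "(h i *\<^sub>R (q i - q v0)) \<bullet> p j + (h j *\<^sub>R (q j - q v0)) \<bullet> p i = g i * h j + g j * h i"
      if t: "(i, j, k) \<in> link" for i j k
    proof -
      have "i \<noteq> j" using linkD(3)[OF t] by auto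
      from edge_preserving_imp_orthogonal[OF pres this link_edge_in_T[OF t]]
      have "((q i - q v0) - (q j - q v0)) \<bullet> ((i - v0) - (j - v0)) = 0" by simp
      then have "(q i - q v0) \<bullet> (j - v0) + (q j - q v0) \<bullet> (i - v0)
          = (q i - q v0) \<bullet> (i - v0) + (q j - q v0) \<bullet> (j - v0)"
        unfolding inner_diff_left[of "q i - q v0"] inner_diff_right[of _ "i - v0"] by linarith
      from arg_cong[OF this, of "\<lambda>x. h i * h j * x"] show ?thesis
        by (simp only: p_def g_def inner_scaleR_left inner_scaleR_right distrib_left mult_ac)
    qed
    show "(i, j, k) \<in> link" by fact
  qed
  then show ?thesis using h[OF link_I(1)[OF l]] by (simp add: g_def)
qed

text \<open>With the radial variations gone, all six edges of each tetrahedron keep their lengths to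
  first order, including those inside \<open>P\<close>, so each tetrahedron moves rigidly.\<close>

lemma deformation_is_rotation:
  assumes vertices: "\<forall>K\<in>D. \<forall>v. v extreme_point_of K \<longrightarrow> v extreme_point_of (convex hull P)"
    and pres: "preserves_edge_lengths T q" and con: "connected (interior P)"
  obtains \<omega> where "\<And>K v. K \<in> D \<Longrightarrow> v extreme_point_of K \<Longrightarrow> q v = q v0 + cross3 \<omega> (v - v0)"
proof -
  have "\<exists>\<omega>. \<forall>v. v extreme_point_of K \<longrightarrow> q v = q v0 + cross3 \<omega> (v - v0)" if "K \<in> D" for K
  proof -
    obtain i j k where t: "(i, j, k) \<in> link" and K: "K = convex hull {v0, i, j, k}"
      using D_eq_link[OF \<open>K \<in> D\<close>] .
    have edge: "(q u - q v0) \<bullet> (v - v0) + (q v - q v0) \<bullet> (u - v0) = 0" if "(u, v, w) \<in> link" for u v w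
    proof -
      have "u \<noteq> v" using linkD(3)[OF that] by auto
      from edge_preserving_imp_orthogonal[OF pres this link_edge_in_T[OF that]]
      have "((q u - q v0) - (q v - q v0)) \<bullet> ((u - v0) - (v - v0)) = 0" by simp
      then show ?thesis
        using no_radial_variation[OF vertices pres that] no_radial_variation[OF vertices pres link_swap[OF that]]
        unfolding inner_diff_left[of "q u - q v0"] inner_diff_right[of _ "u - v0"] by linarith
    qed
    note t2 = link_cyclic[OF t] and t3 = link_cyclic[OF link_cyclic[OF t]]
    obtain \<omega> where "q i - q v0 = cross3 \<omega> (i - v0)" "q j - q v0 = cross3 \<omega> (j - v0)"
      "q k - q v0 = cross3 \<omega> (k - v0)"
      by (rule rotation_vector_exists[OF triple_product_nonzero[OF linkD(2,3)[OF t]]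
            no_radial_variation[OF vertices pres t] no_radial_variation[OF vertices pres t2]
            no_radial_variation[OF vertices pres t3] edge[OF t] edge[OF t2] edge[OF t3]])
    then show ?thesis
      unfolding K extreme_point_of_convex_hull_affine_independent[OF linkD(2)[OF t]]
      by (intro exI[of _ \<omega>]) (auto simp: algebra_simps)
  qed
  then obtain \<omega> where \<omega>: "\<And>K v. K \<in> D \<Longrightarrow> v extreme_point_of K \<Longrightarrow> q v = q v0 + cross3 (\<omega> K) (v - v0)"
    by metis
  have agree: "\<omega> K = \<omega> L" if "K \<in> D" "L \<in> D" for K L
    by (rule rotation_vectors_agree[where q = q and \<omega> = \<omega>]) (use \<omega> con that in auto)
  show ?thesis
  proof (cases "D = {}")
    case False
    then obtain K where "K \<in> D" by blast
    then show ?thesis using that[of "\<omega> K"] \<omega> agree by metis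
  qed (use that in auto)
qed

end

theorem theorem1p2:
  fixes P :: "(real^3) set" and T :: "(real^3) set set" and v0 :: "real^3"
  assumes "solid_polyhedron P"
    and "weakly_convex P"
    and "boundary_triangulation P T"
    and "v0 \<in> vertices_of P"
    and "star_shaped_wrt P T v0"
  shows "infinitesimally_rigid T"
proof -
  obtain D where D: "triangulation D" "\<Union>D = P"
    "\<And>K. K \<in> D \<Longrightarrow> 3 simplex K \<and> v0 extreme_point_of K \<and>
        (\<forall>v. v extreme_point_of K \<longrightarrow> v \<in> vertices_of P)"
    "\<And>K s. K \<in> D \<Longrightarrow> s \<in> T \<Longrightarrow> (K \<inter> s) face_of K \<and> (K \<inter> s) face_of s"
    using assms(5) unfolding star_shaped_wrt_def by blast
  have P: "closed P" "connected (interior P)"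
    using assms(1) by (auto simp: solid_polyhedron_def compact_imp_closed)
  have T: "simplicial_complex T" "\<Union>T = frontier P" "complex_vertices T = vertices_of P"
    using assms(3) by (auto simp: boundary_triangulation_def)
  interpret star_triangulation P T D v0
    using P(1) T(1,2) D by unfold_locales auto
  have extreme: "v extreme_point_of (convex hull P)" if "v \<in> vertices_of P" for v
    using assms(2) that by (simp add: weakly_convex_def)
  \<comment> \<open>Triviality is claimed at all vertices of \<open>P\<close>. Each lies in some
    tetrahedron and, being extreme in the hull of \<open>P\<close>, is extreme in that smaller set
    too.\<close>
  have vertex: "\<exists>K\<in>D. v extreme_point_of K" if "v \<in> vertices_of P" for v
  proof -
    have "v \<in> P"
      using that P(1) frontier_subset_closed
      by (auto simp: vertices_of_def surface_vertices_def)
    then obtain K where K: "K \<in> D" "v \<in> K" using D(2) by blast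
    moreover have "K \<subseteq> convex hull P" using K(1) D(2) hull_subset[of P convex] by blast
    ultimately show ?thesis
      using extreme[OF that] unfolding extreme_point_of_def by blast
  qed
  show ?thesis
    unfolding infinitesimally_rigid_def
  proof (intro allI impI)
    fix q assume q: "preserves_edge_lengths T q"
    obtain \<omega> where "\<And>K v. K \<in> D \<Longrightarrow> v extreme_point_of K \<Longrightarrow> q v = q v0 + cross3 \<omega> (v - v0)"
      using deformation_is_rotation[OF _ q P(2)] D(3) extreme by blast
    then show "trivial_deformation T q"
      unfolding trivial_deformation_def T(3)
      using killing_field_rotation[of "q v0" \<omega> v0] vertex by blast
  qed
qed

end
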